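(* Every semihereditary Bézout ring of countable character is an elementary divisor ring.
   Context: All rings are commutative with identity. A ring is semihereditary if every finitely generated ideal is projective, and Bézout if every finitely generated ideal is principal. A ring $R$ is of countable character if every non-zero-divisor of $R$ is contained in at most countably many maximal ideals. A ring $R$ is an elementary divisor ring if for every (rectangular) matrix $A$ over $R$ there are invertible matrices $P,Q$ over $R$ such that $PAQ$ is diagonal with each diagonal entry dividing the next one. *)

theory Defs
  imports
    "HOL-Algebra.Ideal"
    "HOL-Algebra.Divisibility"
    "HOL-Library.Countable_Set"
    "Jordan_Normal_Form.Matrix"
    "Jordan_Normal_Form.Missing_VectorSpace"
begin

section \<open>Projective modules\<close>

text \<open>
  Projectivity is the lifting property along surjective homomorphisms \<open>g : M \<rightarrow> N\<close>. A definition
  cannot quantify over types, so the carriers of \<open>M\<close> and \<open>N\<close> live in two fixed types, which are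
  large enough for the free module on the carrier of \<open>P\<close> and for \<open>P\<close> itself. Lemma
  \<open>projective_module_lift\<close> below shows that this yields the lifting property for modules \<open>M\<close> and
  \<open>N\<close> over arbitrary types.
\<close>

definition projective_module :: "('a, 'r) ring_scheme \<Rightarrow> ('a, 'p) module \<Rightarrow> bool" where
  "projective_module R P \<longleftrightarrow> Module.module R P \<and>
     (\<forall>(M :: ('a, 'p \<Rightarrow> 'a) module) (N :: ('a, 'p) module) g f.
        Module.module R M \<longrightarrow> Module.module R N \<longrightarrow>
        g \<in> LinearCombinations.module_hom R M N \<longrightarrow> g ` carrier M = carrier N \<longrightarrow>
        f \<in> LinearCombinations.module_hom R P N \<longrightarrow>
        (\<exists>h \<in> LinearCombinations.module_hom R P M. \<forall>x \<in> carrier P. g (h x) = f x))"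

definition free_module :: "('a, 'r) ring_scheme \<Rightarrow> 'p set \<Rightarrow> ('a, 'p \<Rightarrow> 'a) module" where
  "free_module R X =
     \<lparr>carrier = {u. (\<forall>x. u x \<in> carrier R) \<and> finite {x. u x \<noteq> \<zero>\<^bsub>R\<^esub>} \<and> {x. u x \<noteq> \<zero>\<^bsub>R\<^esub>} \<subseteq> X},
      monoid.mult = (\<lambda>u v. undefined), one = undefined,
      zero = (\<lambda>x. \<zero>\<^bsub>R\<^esub>), add = (\<lambda>u v x. u x \<oplus>\<^bsub>R\<^esub> v x), smult = (\<lambda>a u x. a \<otimes>\<^bsub>R\<^esub> u x)\<rparr>"

definition free_eval ::
  "('a, 'r) ring_scheme \<Rightarrow> ('a, 'm, 'e) module_scheme \<Rightarrow> ('p \<Rightarrow> 'm) \<Rightarrow> ('p \<Rightarrow> 'a) \<Rightarrow> 'm" where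
  "free_eval R M b u = (\<Oplus>\<^bsub>M\<^esub>x \<in> {x. u x \<noteq> \<zero>\<^bsub>R\<^esub>}. u x \<odot>\<^bsub>M\<^esub> b x)"

lemma (in cring) module_free_module: "Module.module R (free_module R X)"
proof (rule moduleI)
  show "abelian_group (free_module R X)"
  proof (rule abelian_groupI)
    fix u v assume u: "u \<in> carrier (free_module R X)" and v: "v \<in> carrier (free_module R X)"
    have sub: "{x. u x \<oplus> v x \<noteq> \<zero>} \<subseteq> {x. u x \<noteq> \<zero>} \<union> {x. v x \<noteq> \<zero>}" by auto
    moreover have "finite {x. u x \<oplus> v x \<noteq> \<zero>}"
      by (rule finite_subset[OF sub]) (use u v in \<open>simp add: free_module_def\<close>)
    ultimately show "u \<oplus>\<^bsub>free_module R X\<^esub> v \<in> carrier (free_module R X)"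
      using u v by (auto simp: free_module_def)
  next
    fix u assume u: "u \<in> carrier (free_module R X)"
    let ?v = "\<lambda>x. \<ominus> u x"
    have sub: "{x. \<ominus> u x \<noteq> \<zero>} \<subseteq> {x. u x \<noteq> \<zero>}" by auto
    moreover have "finite {x. \<ominus> u x \<noteq> \<zero>}"
      by (rule finite_subset[OF sub]) (use u in \<open>simp add: free_module_def\<close>)
    ultimately have "?v \<in> carrier (free_module R X)"
      using u by (auto simp: free_module_def)
    moreover from u have "?v \<oplus>\<^bsub>free_module R X\<^esub> u = \<zero>\<^bsub>free_module R X\<^esub>"
      by (auto simp: free_module_def l_neg)
    ultimately show "\<exists>v\<in>carrier (free_module R X). v \<oplus>\<^bsub>free_module R X\<^esub> u = \<zero>\<^bsub>free_module R X\<^esub>"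
      by blast
  qed (auto simp: free_module_def a_ac)
next
  fix a u assume a: "a \<in> carrier R" and u: "u \<in> carrier (free_module R X)"
  have sub: "{x. a \<otimes> u x \<noteq> \<zero>} \<subseteq> {x. u x \<noteq> \<zero>}" using a by auto
  moreover have "finite {x. a \<otimes> u x \<noteq> \<zero>}"
    by (rule finite_subset[OF sub]) (use u in \<open>simp add: free_module_def\<close>)
  ultimately show "a \<odot>\<^bsub>free_module R X\<^esub> u \<in> carrier (free_module R X)"
    using a u by (auto simp: free_module_def)
qed (auto simp: free_module_def l_distr r_distr m_assoc is_cring)

lemma free_eval_superset:
  assumes "Module.module R M" "u \<in> carrier (free_module R X)" "b \<in> X \<rightarrow> carrier M"
    and A: "finite A" "{x. u x \<noteq> \<zero>\<^bsub>R\<^esub>} \<subseteq> A" "A \<subseteq> X"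
  shows "free_eval R M b u = (\<Oplus>\<^bsub>M\<^esub>x \<in> A. u x \<odot>\<^bsub>M\<^esub> b x)"
proof -
  interpret module R M by fact
  show ?thesis unfolding free_eval_def
    by (rule M.add.finprod_mono_neutral_cong_left)
      (use assms in \<open>auto simp: free_module_def Pi_def subset_iff\<close>)
qed

lemma free_eval_hom:
  assumes "Module.module R M" and b: "b \<in> X \<rightarrow> carrier M"
  shows "free_eval R M b \<in> LinearCombinations.module_hom R (free_module R X) M"
proof -
  interpret module R M by fact
  interpret F: module R "free_module R X" by (rule R.module_free_module)
  let ?S = "\<lambda>u. {x. u x \<noteq> \<zero>\<^bsub>R\<^esub>}"
  show ?thesis unfolding LinearCombinations.module_hom_def
  proof (intro CollectI conjI allI impI funcsetI; (elim conjE)?)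
    fix u assume u: "u \<in> carrier (free_module R X)"
    then show "free_eval R M b u \<in> carrier M" unfolding free_eval_def
      by (intro M.finsum_closed) (use b in \<open>auto simp: free_module_def Pi_def subset_iff\<close>)
  next
    fix u v assume u: "u \<in> carrier (free_module R X)" and v: "v \<in> carrier (free_module R X)"
    let ?A = "?S u \<union> ?S v"
    have A: "finite ?A" "?A \<subseteq> X" using u v by (auto simp: free_module_def)
    have uv: "u \<oplus>\<^bsub>free_module R X\<^esub> v = (\<lambda>x. u x \<oplus>\<^bsub>R\<^esub> v x)" by (simp add: free_module_def)
    have c: "u x \<in> carrier R" "v x \<in> carrier R" for x
      using u v by (auto simp: free_module_def)
    have bA: "b x \<in> carrier M" if "x \<in> ?A" for x using A(2) b that by auto
    have "free_eval R M b (u \<oplus>\<^bsub>free_module R X\<^esub> v)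
        = (\<Oplus>\<^bsub>M\<^esub>x\<in>?A. (u \<oplus>\<^bsub>free_module R X\<^esub> v) x \<odot>\<^bsub>M\<^esub> b x)"
      by (rule free_eval_superset[OF assms(1) F.a_closed[OF u v] b A(1) _ A(2)])
        (auto simp: uv)
    also have "\<dots> = (\<Oplus>\<^bsub>M\<^esub>x\<in>?A. u x \<odot>\<^bsub>M\<^esub> b x \<oplus>\<^bsub>M\<^esub> v x \<odot>\<^bsub>M\<^esub> b x)"
      by (rule M.finsum_cong') (use bA c in \<open>auto simp: uv smult_l_distr\<close>)
    also have "\<dots> = (\<Oplus>\<^bsub>M\<^esub>x\<in>?A. u x \<odot>\<^bsub>M\<^esub> b x) \<oplus>\<^bsub>M\<^esub> (\<Oplus>\<^bsub>M\<^esub>x\<in>?A. v x \<odot>\<^bsub>M\<^esub> b x)"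
      by (rule M.finsum_addf) (use bA c in auto)
    also have "(\<Oplus>\<^bsub>M\<^esub>x\<in>?A. u x \<odot>\<^bsub>M\<^esub> b x) = free_eval R M b u"
      by (rule free_eval_superset[OF assms(1) u b A(1) _ A(2), symmetric]) auto
    also have "(\<Oplus>\<^bsub>M\<^esub>x\<in>?A. v x \<odot>\<^bsub>M\<^esub> b x) = free_eval R M b v"
      by (rule free_eval_superset[OF assms(1) v b A(1) _ A(2), symmetric]) auto
    finally show "free_eval R M b (u \<oplus>\<^bsub>free_module R X\<^esub> v)
        = free_eval R M b u \<oplus>\<^bsub>M\<^esub> free_eval R M b v" .
  next
    fix a u assume a: "a \<in> carrier R" and u: "u \<in> carrier (free_module R X)"
    have A: "finite (?S u)" "?S u \<subseteq> X" using u by (auto simp: free_module_def)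
    have au: "a \<odot>\<^bsub>free_module R X\<^esub> u = (\<lambda>x. a \<otimes>\<^bsub>R\<^esub> u x)" by (simp add: free_module_def)
    have c: "u x \<in> carrier R" for x using u by (auto simp: free_module_def)
    have bA: "b x \<in> carrier M" if "x \<in> ?S u" for x using A(2) b that by auto
    have "free_eval R M b (a \<odot>\<^bsub>free_module R X\<^esub> u)
        = (\<Oplus>\<^bsub>M\<^esub>x\<in>?S u. (a \<odot>\<^bsub>free_module R X\<^esub> u) x \<odot>\<^bsub>M\<^esub> b x)"
      by (rule free_eval_superset[OF assms(1) F.smult_closed[OF a u] b A(1) _ A(2)])
        (use a in \<open>auto simp: au\<close>)
    also have "\<dots> = (\<Oplus>\<^bsub>M\<^esub>x\<in>?S u. a \<odot>\<^bsub>M\<^esub> (u x \<odot>\<^bsub>M\<^esub> b x))"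
      by (rule M.finsum_cong') (use a bA c in \<open>auto simp: au smult_assoc1\<close>)
    also have "\<dots> = a \<odot>\<^bsub>M\<^esub> free_eval R M b u" unfolding free_eval_def
      by (rule finsum_smult_ldistr[symmetric]) (use a A bA c in auto)
    finally show "free_eval R M b (a \<odot>\<^bsub>free_module R X\<^esub> u) = a \<odot>\<^bsub>M\<^esub> free_eval R M b u" .
  qed
qed

lemma free_eval_surj:
  assumes "Module.module R M"
  shows "free_eval R M (\<lambda>x. x) ` carrier (free_module R (carrier M)) = carrier M"
proof -
  interpret module R M by fact
  have "x \<in> free_eval R M (\<lambda>x. x) ` carrier (free_module R (carrier M))" if x: "x \<in> carrier M" for x
  proof (rule image_eqI)
    let ?u = "\<lambda>y. if y = x then \<one>\<^bsub>R\<^esub> else \<zero>\<^bsub>R\<^esub>"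
    show u: "?u \<in> carrier (free_module R (carrier M))"
      using x by (auto simp: free_module_def)
    have "free_eval R M (\<lambda>x. x) ?u = (\<Oplus>\<^bsub>M\<^esub>y \<in> {x}. ?u y \<odot>\<^bsub>M\<^esub> y)"
      by (rule free_eval_superset[OF assms u]) (use x in auto)
    then show "x = free_eval R M (\<lambda>x. x) ?u"
      using x by simp
  qed
  moreover have "free_eval R M (\<lambda>x. x) \<in> carrier (free_module R (carrier M)) \<rightarrow> carrier M"
    by (rule LinearCombinations.module_hom_closed[OF free_eval_hom[OF assms]]) auto
  ultimately show ?thesis by blast
qed

lemma hom_free_eval:
  assumes "Module.module R M" "Module.module R N"
    and f: "f \<in> LinearCombinations.module_hom R M N"
    and u: "u \<in> carrier (free_module R X)" and b: "b \<in> X \<rightarrow> carrier M"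
  shows "f (free_eval R M b u) = free_eval R N (\<lambda>x. f (b x)) u"
proof -
  interpret module R M by fact
  interpret N: module R N by fact
  have fc: "f m \<in> carrier N" if "m \<in> carrier M" for m
    using LinearCombinations.module_hom_closed[OF f] that by auto
  have f0: "f \<zero>\<^bsub>M\<^esub> = \<zero>\<^bsub>N\<^esub>"
    using LinearCombinations.module_hom_smult[OF f R.zero_closed M.zero_closed] fc by simp
  have c: "u x \<in> carrier R" for x using u by (auto simp: free_module_def)
  have "f (\<Oplus>\<^bsub>M\<^esub>x \<in> A. u x \<odot>\<^bsub>M\<^esub> b x) = (\<Oplus>\<^bsub>N\<^esub>x \<in> A. u x \<odot>\<^bsub>N\<^esub> f (b x))"
    if "finite A" "A \<subseteq> X" for A
    using that
  proof (induction A rule: finite_induct)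
    case empty
    then show ?case by (simp add: f0)
  next
    case (insert y A)
    have bA: "b x \<in> carrier M" if "x \<in> insert y A" for x using insert.prems b that by auto
    have "f (u y \<odot>\<^bsub>M\<^esub> b y \<oplus>\<^bsub>M\<^esub> (\<Oplus>\<^bsub>M\<^esub>x \<in> A. u x \<odot>\<^bsub>M\<^esub> b x))
        = u y \<odot>\<^bsub>N\<^esub> f (b y) \<oplus>\<^bsub>N\<^esub> f (\<Oplus>\<^bsub>M\<^esub>x \<in> A. u x \<odot>\<^bsub>M\<^esub> b x)"
      using bA c by (simp add: LinearCombinations.module_hom_add[OF f]
          LinearCombinations.module_hom_smult[OF f] Pi_def)
    then show ?case
      using insert bA c fc by (simp add: Pi_def)
  qed
  then show ?thesis
    using u by (auto simp: free_eval_def free_module_def)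
qed

lemma projective_module_lift:
  fixes M :: "('a, 'm, 'd) module_scheme" and N :: "('a, 'n, 'e) module_scheme"
  assumes P: "projective_module R P"
    and M: "Module.module R M" and N: "Module.module R N"
    and g: "g \<in> LinearCombinations.module_hom R M N" "g ` carrier M = carrier N"
    and f: "f \<in> LinearCombinations.module_hom R P N"
  shows "\<exists>h \<in> LinearCombinations.module_hom R P M. \<forall>x \<in> carrier P. g (h x) = f x"
proof -
  have modP: "Module.module R P" using P by (simp add: projective_module_def)
  interpret P: module R P by fact
  let ?F = "free_module R (carrier P)"
  have eP: "free_eval R P (\<lambda>x. x) \<in> LinearCombinations.module_hom R ?F P"
    by (rule free_eval_hom[OF modP]) auto
  have idP: "(\<lambda>x. x) \<in> LinearCombinations.module_hom R P P"
    by (auto simp: LinearCombinations.module_hom_def)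
  obtain s where s: "s \<in> LinearCombinations.module_hom R P ?F"
    and es: "\<And>x. x \<in> carrier P \<Longrightarrow> free_eval R P (\<lambda>x. x) (s x) = x"
    using P P.R.module_free_module[of "carrier P"] modP eP free_eval_surj[OF modP] idP
    unfolding projective_module_def by metis
  have sc: "s x \<in> carrier ?F" if "x \<in> carrier P" for x
    using LinearCombinations.module_hom_closed[OF s] that by auto
  have "\<forall>x \<in> carrier P. \<exists>m \<in> carrier M. g m = f x"
  proof
    fix x assume "x \<in> carrier P"
    then have "f x \<in> g ` carrier M"
      using g(2) LinearCombinations.module_hom_closed[OF f] by blast
    then show "\<exists>m \<in> carrier M. g m = f x" by force
  qed
  then obtain b where b: "\<And>x. x \<in> carrier P \<Longrightarrow> b x \<in> carrier M \<and> g (b x) = f x"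
    by metis
  have eM: "free_eval R M b \<in> LinearCombinations.module_hom R ?F M"
    by (rule free_eval_hom[OF M]) (use b in auto)
  have hom: "(\<lambda>x. free_eval R M b (s x)) \<in> LinearCombinations.module_hom R P M"
    unfolding LinearCombinations.module_hom_def
    using sc LinearCombinations.module_hom_closed[OF eM]
    by (auto simp: LinearCombinations.module_hom_add[OF s] LinearCombinations.module_hom_smult[OF s]
        LinearCombinations.module_hom_add[OF eM] LinearCombinations.module_hom_smult[OF eM])
  have lift: "g (free_eval R M b (s x)) = f x" if x: "x \<in> carrier P" for x
  proof -
    have "g (free_eval R M b (s x)) = free_eval R N (\<lambda>y. g (b y)) (s x)"
      by (rule hom_free_eval[OF M N g(1) sc[OF x]]) (use b in auto)
    also have "\<dots> = free_eval R N f (s x)"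
    proof -
      have "y \<in> carrier P" if "s x y \<noteq> \<zero>\<^bsub>R\<^esub>" for y
        using sc[OF x] that by (auto simp: free_module_def)
      moreover interpret N: module R N by fact
      have "s x y \<in> carrier R" for y
        using sc[OF x] by (auto simp: free_module_def)
      ultimately show ?thesis
        unfolding free_eval_def
        using LinearCombinations.module_hom_closed[OF f] b
        by (intro N.M.finsum_cong') (auto simp: Pi_def)
    qed
    also have "\<dots> = f (free_eval R P (\<lambda>y. y) (s x))"
      by (rule hom_free_eval[OF modP N f sc[OF x], symmetric]) auto
    finally show ?thesis using es[OF x] by simp
  qed
  show ?thesis
    by (rule bexI[OF _ hom]) (simp add: lift)
qed


section \<open>Classes of commutative rings\<close>

text \<open>The fields \<open>mult\<close> and \<open>one\<close> of a module record play no role in \<^locale>\<open>Module.module\<close>.\<close>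

definition ideal_module :: "('a, 'r) ring_scheme \<Rightarrow> 'a set \<Rightarrow> ('a, 'a) module" where
  "ideal_module R I =
     \<lparr>carrier = I, monoid.mult = monoid.mult R, one = one R, zero = zero R, add = add R,
      smult = monoid.mult R\<rparr>"

lemma (in cring) module_ideal_module:
  assumes "ideal I R"
  shows "Module.module R (ideal_module R I)"
proof -
  interpret ideal I R by fact
  show ?thesis
  proof (rule moduleI)
    show "abelian_group (ideal_module R I)"
    proof (rule abelian_groupI)
      fix x assume "x \<in> carrier (ideal_module R I)"
      then show "\<exists>y\<in>carrier (ideal_module R I).
          y \<oplus>\<^bsub>ideal_module R I\<^esub> x = \<zero>\<^bsub>ideal_module R I\<^esub>"
        by (intro bexI[of _ "\<ominus> x"]) (auto simp: ideal_module_def l_neg Icarr)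
    qed (auto simp: ideal_module_def a_ac Icarr)
  qed (auto simp: ideal_module_def l_distr r_distr m_assoc Icarr is_cring I_l_closed)
qed

definition semihereditary :: "('a, 'r) ring_scheme \<Rightarrow> bool" where
  "semihereditary R \<longleftrightarrow>
     (\<forall>S. finite S \<longrightarrow> S \<subseteq> carrier R \<longrightarrow> projective_module R (ideal_module R (Idl\<^bsub>R\<^esub> S)))"

definition bezout_ring :: "('a, 'r) ring_scheme \<Rightarrow> bool" where
  "bezout_ring R \<longleftrightarrow> (\<forall>S. finite S \<longrightarrow> S \<subseteq> carrier R \<longrightarrow> principalideal (Idl\<^bsub>R\<^esub> S) R)"

definition non_zero_divisor :: "('a, 'r) ring_scheme \<Rightarrow> 'a \<Rightarrow> bool" where
  "non_zero_divisor R a \<longleftrightarrow>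
     a \<in> carrier R \<and> (\<forall>b \<in> carrier R. a \<otimes>\<^bsub>R\<^esub> b = \<zero>\<^bsub>R\<^esub> \<longrightarrow> b = \<zero>\<^bsub>R\<^esub>)"

definition countable_character :: "('a, 'r) ring_scheme \<Rightarrow> bool" where
  "countable_character R \<longleftrightarrow>
     (\<forall>a. non_zero_divisor R a \<longrightarrow> countable {M. maximalideal M R \<and> a \<in> M})"


section \<open>Matrices over a ring with explicit carrier\<close>

text \<open>
  Only the type \<^typ>\<open>'a mat\<close> and its indexing operations are taken from the matrix library: its
  arithmetic is tied to type classes and does not apply to the operations of a ring record.
\<close>

definition mats :: "('a, 'r) ring_scheme \<Rightarrow> nat \<Rightarrow> nat \<Rightarrow> 'a mat set" where
  "mats R m n = {A \<in> carrier_mat m n. \<forall>i < m. \<forall>j < n. A $$ (i, j) \<in> carrier R}"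

definition mmult :: "('a, 'r) ring_scheme \<Rightarrow> 'a mat \<Rightarrow> 'a mat \<Rightarrow> 'a mat" where
  "mmult R A B = mat (dim_row A) (dim_col B)
     (\<lambda>(i, j). \<Oplus>\<^bsub>R\<^esub>k \<in> {..<dim_col A}. A $$ (i, k) \<otimes>\<^bsub>R\<^esub> B $$ (k, j))"

definition mone :: "('a, 'r) ring_scheme \<Rightarrow> nat \<Rightarrow> 'a mat" where
  "mone R n = mat n n (\<lambda>(i, j). if i = j then \<one>\<^bsub>R\<^esub> else \<zero>\<^bsub>R\<^esub>)"

definition invertible_mats :: "('a, 'r) ring_scheme \<Rightarrow> nat \<Rightarrow> 'a mat set" where
  "invertible_mats R n =
     {P \<in> mats R n n. \<exists>P' \<in> mats R n n. mmult R P P' = mone R n \<and> mmult R P' P = mone R n}"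

definition diagonal_divisibility_form :: "('a, 'r) ring_scheme \<Rightarrow> 'a mat \<Rightarrow> bool" where
  "diagonal_divisibility_form R D \<longleftrightarrow>
     (\<forall>i < dim_row D. \<forall>j < dim_col D. i \<noteq> j \<longrightarrow> D $$ (i, j) = \<zero>\<^bsub>R\<^esub>) \<and>
     (\<forall>i. Suc i < min (dim_row D) (dim_col D) \<longrightarrow>
        D $$ (i, i) divides\<^bsub>R\<^esub> D $$ (Suc i, Suc i))"

definition elementary_divisor_ring :: "('a, 'r) ring_scheme \<Rightarrow> bool" where
  "elementary_divisor_ring R \<longleftrightarrow>
     (\<forall>m n. \<forall>A \<in> mats R m n. \<exists>P \<in> invertible_mats R m. \<exists>Q \<in> invertible_mats R n.
        diagonal_divisibility_form R (mmult R (mmult R P A) Q))"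

end

theory Submission
  imports Defs
begin

text \<open>
  Semihereditarity makes the annihilator of every element the ideal generated by an idempotent. With
  the Bezout property this makes \<open>R\<close> a Hermite ring, and by Kaplansky's reduction it remains to find,
  for a lower triangular matrix with rows \<open>(d, 0)\<close>, \<open>(x, y)\<close> and unimodular entries, a row vector whose
  product with the matrix is unimodular. Cutting with an idempotent, one may assume that \<open>d\<close> is not a
  zero divisor and thus lies in at most countably many maximal ideals \<open>M\<^sub>0, M\<^sub>1, \<dots>\<close>. Given one such \<open>M\<close>,
  invertible row and column operations shrink the closed set of maximal ideals containing the first
  row, so that it avoids \<open>M\<close>. If no finite number of such steps made this set empty, then, by
  compactness, some maximal ideal would survive all steps; but it is one of the \<open>M\<^sub>n\<close>.
\<close>

section \<open>Maximal ideals\<close>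

text \<open>A row vector cannot be corrected at infinitely many maximal ideals in turn, so the
  matrix is changed instead. Solvability pulls back along row and column operations, and each step
  keeps what the earlier ones gained because the set of maximal ideals containing the first row only
  shrinks. Once that set is empty, the row vector \<open>(1, 0)\<close> is a solution. The steps do
  not preserve the triangular form, hence all four entries are carried along.

  Idempotents repair the two places where zero divisors interfere: cancelling the gcd from a Bezout
  identity, and using the countability hypothesis, which speaks of non-zero-divisors only. Each time
  the ring splits into a factor on which the element is regular and a factor on which it is zero.

  Divisibility along the diagonal costs nothing: the gcd of all entries is split off before each
  reduction, so the pivot of what remains is 1.\<close>

context cring
begin

text \<open>With \<open>x\<close> fixed, these rules move \<open>x\<close> and its negative forward
  in a sum until \<open>r_neg1\<close> or \<open>r_neg2\<close> cancels them.\<close>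

lemma swap_neg:
  assumes "x \<in> carrier R" "u \<in> carrier R" "w \<in> carrier R"
  shows "u \<oplus> (\<ominus> x \<oplus> w) = \<ominus> x \<oplus> (u \<oplus> w)" "u \<oplus> (x \<oplus> w) = x \<oplus> (u \<oplus> w)"
  using assms by (simp_all add: a_ac)

text \<open>
  \<open>cring_simprules\<close> sorts sums, but cancels a term against its negative only if the two end up
  adjacent; the following rules also cancel them at a small distance.
\<close>

lemma neg_cancel:
  "\<lbrakk>x \<in> carrier R; a \<in> carrier R; z \<in> carrier R\<rbrakk>
    \<Longrightarrow> x \<oplus> (a \<oplus> (\<ominus> x \<oplus> z)) = a \<oplus> z"
  "\<lbrakk>x \<in> carrier R; a \<in> carrier R; z \<in> carrier R\<rbrakk>
    \<Longrightarrow> \<ominus> x \<oplus> (a \<oplus> (x \<oplus> z)) = a \<oplus> z"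
  "\<lbrakk>x \<in> carrier R; a \<in> carrier R; b \<in> carrier R; z \<in> carrier R\<rbrakk>
    \<Longrightarrow> x \<oplus> (a \<oplus> (b \<oplus> (\<ominus> x \<oplus> z))) = a \<oplus> (b \<oplus> z)"
  "\<lbrakk>x \<in> carrier R; a \<in> carrier R; b \<in> carrier R; z \<in> carrier R\<rbrakk>
    \<Longrightarrow> \<ominus> x \<oplus> (a \<oplus> (b \<oplus> (x \<oplus> z))) = a \<oplus> (b \<oplus> z)"
  "\<lbrakk>x \<in> carrier R; a \<in> carrier R; b \<in> carrier R; c \<in> carrier R; z \<in> carrier R\<rbrakk>
    \<Longrightarrow> x \<oplus> (a \<oplus> (b \<oplus> (c \<oplus> (\<ominus> x \<oplus> z)))) = a \<oplus> (b \<oplus> (c \<oplus> z))"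
  "\<lbrakk>x \<in> carrier R; a \<in> carrier R; b \<in> carrier R; c \<in> carrier R; z \<in> carrier R\<rbrakk>
    \<Longrightarrow> \<ominus> x \<oplus> (a \<oplus> (b \<oplus> (c \<oplus> (x \<oplus> z)))) = a \<oplus> (b \<oplus> (c \<oplus> z))"
  by (simp_all only: swap_neg[of x] a_closed a_inv_closed r_neg1 r_neg2)

lemma neg_cancel_last:
  "\<lbrakk>x \<in> carrier R; a \<in> carrier R\<rbrakk>
    \<Longrightarrow> x \<oplus> (a \<oplus> \<ominus> x) = a"
  "\<lbrakk>x \<in> carrier R; a \<in> carrier R\<rbrakk>
    \<Longrightarrow> \<ominus> x \<oplus> (a \<oplus> x) = a"
  "\<lbrakk>x \<in> carrier R; a \<in> carrier R; b \<in> carrier R\<rbrakk>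
    \<Longrightarrow> x \<oplus> (a \<oplus> (b \<oplus> \<ominus> x)) = a \<oplus> b"
  "\<lbrakk>x \<in> carrier R; a \<in> carrier R; b \<in> carrier R\<rbrakk>
    \<Longrightarrow> \<ominus> x \<oplus> (a \<oplus> (b \<oplus> x)) = a \<oplus> b"
  "\<lbrakk>x \<in> carrier R; a \<in> carrier R; b \<in> carrier R; c \<in> carrier R\<rbrakk>
    \<Longrightarrow> x \<oplus> (a \<oplus> (b \<oplus> (c \<oplus> \<ominus> x))) = a \<oplus> (b \<oplus> c)"
  "\<lbrakk>x \<in> carrier R; a \<in> carrier R; b \<in> carrier R; c \<in> carrier R\<rbrakk>
    \<Longrightarrow> \<ominus> x \<oplus> (a \<oplus> (b \<oplus> (c \<oplus> x))) = a \<oplus> (b \<oplus> c)"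
  using neg_cancel[where z = \<zero>] by simp_all

lemmas ring_norm = cring_simprules neg_cancel neg_cancel_last

section \<open>Membership in maximal ideals and their existence\<close>

lemma maximalideal_mult_iff:
  assumes "maximalideal N R" "x \<in> carrier R" "y \<in> carrier R"
  shows "x \<otimes> y \<in> N \<longleftrightarrow> x \<in> N \<or> y \<in> N"
proof -
  interpret N: primeideal N R using maximalideal_prime[OF assms(1)] .
  show ?thesis using N.I_prime[of x y] N.I_l_closed N.I_r_closed assms by auto
qed

lemma maximalideal_add:
  "\<lbrakk>maximalideal N R; x \<in> N; y \<in> N\<rbrakk> \<Longrightarrow> x \<oplus> y \<in> N"
  by (meson additive_subgroup.a_closed ideal.axioms(1) maximalideal.axioms(1))

lemma maximalideal_add_iff:
  assumes "maximalideal N R" "x \<in> N" "y \<in> carrier R"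
  shows "x \<oplus> y \<in> N \<longleftrightarrow> y \<in> N" and "y \<oplus> x \<in> N \<longleftrightarrow> y \<in> N"
proof -
  interpret N: maximalideal N R by fact
  have x: "x \<in> carrier R" using assms(2) by (rule N.Icarr)
  show *: "x \<oplus> y \<in> N \<longleftrightarrow> y \<in> N"
  proof
    assume "x \<oplus> y \<in> N"
    then have "\<ominus> x \<oplus> (x \<oplus> y) \<in> N" using assms(2) N.a_closed N.a_inv_closed by blast
    then show "y \<in> N" using x assms(3) by (simp add: r_neg1)
  qed (use assms(2) N.a_closed in blast)
  show "y \<oplus> x \<in> N \<longleftrightarrow> y \<in> N" using * x assms(3) by (simp add: a_comm)
qed

lemma maximalideal_minus_iff:
  assumes "maximalideal N R" "x \<in> carrier R"
  shows "\<ominus> x \<in> N \<longleftrightarrow> x \<in> N"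
proof -
  interpret N: maximalideal N R by fact
  show ?thesis using N.a_inv_closed[of x] N.a_inv_closed[of "\<ominus> x"] assms(2) by auto
qed

lemma maximalideal_zero: "maximalideal N R \<Longrightarrow> \<zero> \<in> N"
  by (meson additive_subgroup.zero_closed ideal.axioms(1) maximalideal.axioms(1))

lemma maximalideal_one: "maximalideal N R \<Longrightarrow> \<one> \<notin> N"
  using ideal.one_imp_carrier maximalideal.I_notcarr maximalideal.axioms(1) by metis

lemmas maximalideal_iffs = maximalideal_mult_iff maximalideal_add_iff maximalideal_minus_iff
  maximalideal_zero maximalideal_one

text \<open>Directedness covers both later uses: the chains in Zorn's lemma and the increasing
  sequence of ideals in the compactness argument.\<close>

lemma ideal_directed_Union:
  assumes ne: "\<C> \<noteq> {}" and id: "\<And>J. J \<in> \<C> \<Longrightarrow> ideal J R"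
    and dir: "\<And>J K. J \<in> \<C> \<Longrightarrow> K \<in> \<C> \<Longrightarrow> \<exists>L\<in>\<C>. J \<union> K \<subseteq> L"
  shows "ideal (\<Union>\<C>) R"
proof (rule idealI)
  show "ring R" by (rule ring_axioms)
  show "subgroup (\<Union>\<C>) (add_monoid R)"
  proof (rule subgroup.intro)
    show "\<Union>\<C> \<subseteq> carrier (add_monoid R)" using ideal.Icarr[OF id] by auto
  next
    fix x y assume "x \<in> \<Union>\<C>" "y \<in> \<Union>\<C>"
    then obtain J K where JK: "J \<in> \<C>" "x \<in> J" "K \<in> \<C>" "y \<in> K" by (elim UnionE)
    obtain L where L: "L \<in> \<C>" "J \<union> K \<subseteq> L" using dir[OF JK(1,3)] by (elim bexE)
    interpret L: ideal L R using id[OF L(1)] .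
    have "x \<oplus> y \<in> L" by (rule L.a_closed) (use JK L(2) in auto)
    then show "x \<otimes>\<^bsub>add_monoid R\<^esub> y \<in> \<Union>\<C>" using L(1) by auto
  next
    obtain J where J: "J \<in> \<C>" using ne by auto
    interpret J: ideal J R using id[OF J] .
    show "\<one>\<^bsub>add_monoid R\<^esub> \<in> \<Union>\<C>" by (rule UnionI[OF J]) simp
  next
    fix x assume "x \<in> \<Union>\<C>"
    then obtain J where J: "J \<in> \<C>" "x \<in> J" by (elim UnionE)
    interpret J: ideal J R using id[OF J(1)] .
    show "inv\<^bsub>add_monoid R\<^esub> x \<in> \<Union>\<C>"
      by (rule UnionI[OF J(1)]) (use J.a_inv_closed[OF J(2)] in \<open>simp add: a_inv_def\<close>)
  qed
next
  fix a x assume "a \<in> \<Union>\<C>" and x: "x \<in> carrier R"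
  then obtain J where J: "J \<in> \<C>" "a \<in> J" by (elim UnionE)
  interpret J: ideal J R using id[OF J(1)] .
  show "x \<otimes> a \<in> \<Union>\<C>" by (rule UnionI[OF J(1)]) (rule J.I_l_closed[OF J(2) x])
  show "a \<otimes> x \<in> \<Union>\<C>" by (rule UnionI[OF J(1)]) (rule J.I_r_closed[OF J(2) x])
qed

lemma exists_maximalideal:
  assumes "ideal I R" "\<one> \<notin> I"
  shows "\<exists>N. maximalideal N R \<and> I \<subseteq> N"
proof -
  let ?\<A> = "{J. ideal J R \<and> I \<subseteq> J \<and> \<one> \<notin> J}"
  have "\<exists>N\<in>?\<A>. \<forall>J\<in>?\<A>. N \<subseteq> J \<longrightarrow> J = N"
  proof (rule subset_Zorn_nonempty)
    show "?\<A> \<noteq> {}" using assms by blast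
  next
    fix \<C> assume ne: "\<C> \<noteq> {}" and ch: "subset.chain ?\<A> \<C>"
    have id: "ideal J R" if "J \<in> \<C>" for J using ch that by (auto simp: subset.chain_def)
    have comp: "J \<subseteq> K \<or> K \<subseteq> J" if "J \<in> \<C>" "K \<in> \<C>" for J K
      using ch that by (auto simp: subset.chain_def)
    have "ideal (\<Union>\<C>) R"
    proof (rule ideal_directed_Union[OF ne id])
      fix J K assume JK: "J \<in> \<C>" "K \<in> \<C>"
      show "\<exists>L\<in>\<C>. J \<union> K \<subseteq> L"
      proof (cases "J \<subseteq> K")
        case True
        then show ?thesis by (intro bexI[OF _ JK(2)]) simp
      next
        case False
        then show ?thesis using comp[OF JK] by (intro bexI[OF _ JK(1)]) simp
      qed
    qed
    moreover have "\<forall>J\<in>\<C>. I \<subseteq> J \<and> \<one> \<notin> J" using ch by (auto simp: subset.chain_def)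
    ultimately show "\<Union>\<C> \<in> ?\<A>" using ne by auto
  qed
  then obtain N where N_in: "N \<in> ?\<A>" and N_max: "\<forall>J\<in>?\<A>. N \<subseteq> J \<longrightarrow> J = N"
    by (rule bexE)
  have N: "ideal N R" "I \<subseteq> N" "\<one> \<notin> N" using N_in by simp_all
  have max: "J = N" if "ideal J R" "I \<subseteq> J" "\<one> \<notin> J" "N \<subseteq> J" for J
    using N_max that by simp
  have "maximalideal N R"
  proof (rule maximalidealI)
    show "ideal N R" by fact
    show "carrier R \<noteq> N" using N(3) by auto
    fix J assume J: "ideal J R" "N \<subseteq> J" "J \<subseteq> carrier R"
    show "J = N \<or> J = carrier R"
      using max[OF J(1) subset_trans[OF N(2) J(2)] _ J(2)] ideal.one_imp_carrier[OF J(1)] by metis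
  qed
  then show ?thesis using N(2) by metis
qed

lemma unit_if_no_maximalideal:
  assumes a: "a \<in> carrier R" and nomax: "\<And>N. maximalideal N R \<Longrightarrow> a \<notin> N"
  shows "\<exists>b\<in>carrier R. a \<otimes> b = \<one>"
proof -
  have "\<one> \<in> PIdl a"
    using exists_maximalideal[OF cgenideal_ideal[OF a]] nomax cgenideal_self[OF a] by blast
  then show ?thesis using a by (auto simp: cgenideal_def m_comm)
qed

text \<open>This amounts to generating the unit ideal. In terms of maximal ideals, it can be checked
  at one \<open>N\<close> at a time, where \<open>maximalideal_iffs\<close> decides membership as in
  a field.\<close>

definition unimodular :: "'a set \<Rightarrow> bool" where
  "unimodular S \<longleftrightarrow> (\<forall>N. maximalideal N R \<longrightarrow> \<not> S \<subseteq> N)"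

section \<open>The two by two problem\<close>

text \<open>
  Some row vector \<open>(p, q)\<close> times the matrix with rows \<open>(a, b)\<close> and \<open>(x, y)\<close> is unimodular.
\<close>

definition row_solvable :: "'a \<Rightarrow> 'a \<Rightarrow> 'a \<Rightarrow> 'a \<Rightarrow> bool" where
  "row_solvable a b x y \<longleftrightarrow>
     (\<exists>p\<in>carrier R. \<exists>q\<in>carrier R. unimodular {p \<otimes> a \<oplus> q \<otimes> x, p \<otimes> b \<oplus> q \<otimes> y})"

text \<open>If \<open>T\<close> has rows \<open>(r, s)\<close> and \<open>(r', s')\<close>, a
  solution \<open>(p, q)\<close> for \<open>T\<close> times the matrix gives the solution
  \<open>(p, q) T\<close> for the matrix itself.\<close>

lemma row_solvable_row_op:
  assumes [simp]: "a \<in> carrier R" "b \<in> carrier R" "x \<in> carrier R" "y \<in> carrier R"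
    "r \<in> carrier R" "s \<in> carrier R" "r' \<in> carrier R" "s' \<in> carrier R"
    and "row_solvable (r \<otimes> a \<oplus> s \<otimes> x) (r \<otimes> b \<oplus> s \<otimes> y) (r' \<otimes> a \<oplus> s' \<otimes> x) (r' \<otimes> b \<oplus> s' \<otimes> y)"
  shows "row_solvable a b x y"
proof -
  obtain p q where [simp]: "p \<in> carrier R" "q \<in> carrier R"
    and u: "unimodular {p \<otimes> (r \<otimes> a \<oplus> s \<otimes> x) \<oplus> q \<otimes> (r' \<otimes> a \<oplus> s' \<otimes> x),
      p \<otimes> (r \<otimes> b \<oplus> s \<otimes> y) \<oplus> q \<otimes> (r' \<otimes> b \<oplus> s' \<otimes> y)}"
    using assms(9) unfolding row_solvable_def by blast
  have "p \<otimes> (r \<otimes> c \<oplus> s \<otimes> z) \<oplus> q \<otimes> (r' \<otimes> c \<oplus> s' \<otimes> z)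
      = (p \<otimes> r \<oplus> q \<otimes> r') \<otimes> c \<oplus> (p \<otimes> s \<oplus> q \<otimes> s') \<otimes> z" if "c \<in> carrier R" "z \<in> carrier R" for c z
    using that by (simp add: ring_norm)
  with u show ?thesis unfolding row_solvable_def
    by (intro bexI[of _ "p \<otimes> r \<oplus> q \<otimes> r'"] bexI[of _ "p \<otimes> s \<oplus> q \<otimes> s'"]) simp_all
qed

text \<open>The columns are multiplied by the matrix with columns \<open>(u, v)\<close> and
  \<open>(-\<beta>, \<alpha>)\<close>, of determinant 1 by \<open>uv\<close>, which turns the first
  row into \<open>(f, 0)\<close>. The same \<open>(p, q)\<close> works before and after: the new
  product consists of combinations of the entries of the old one, so a maximal ideal containing the
  old entries contains the new ones.\<close>

lemma row_solvable_column_op: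
  assumes [simp]: "f \<in> carrier R" "\<alpha> \<in> carrier R" "\<beta> \<in> carrier R" "x \<in> carrier R" "y \<in> carrier R"
    "u \<in> carrier R" "v \<in> carrier R"
    and "row_solvable f \<zero> (u \<otimes> x \<oplus> v \<otimes> y) (\<alpha> \<otimes> y \<ominus> \<beta> \<otimes> x)"
    and uv: "u \<otimes> \<alpha> \<oplus> v \<otimes> \<beta> = \<one>"
  shows "row_solvable (f \<otimes> \<alpha>) (f \<otimes> \<beta>) x y"
proof -
  obtain p q where [simp]: "p \<in> carrier R" "q \<in> carrier R"
    and un: "unimodular {p \<otimes> f \<oplus> q \<otimes> (u \<otimes> x \<oplus> v \<otimes> y), p \<otimes> \<zero> \<oplus> q \<otimes> (\<alpha> \<otimes> y \<ominus> \<beta> \<otimes> x)}"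
    using assms(8) unfolding row_solvable_def by blast
  let ?c = "p \<otimes> (f \<otimes> \<alpha>) \<oplus> q \<otimes> x" and ?d = "p \<otimes> (f \<otimes> \<beta>) \<oplus> q \<otimes> y"
  have "u \<otimes> ?c \<oplus> v \<otimes> ?d = p \<otimes> f \<otimes> (u \<otimes> \<alpha> \<oplus> v \<otimes> \<beta>) \<oplus> q \<otimes> (u \<otimes> x \<oplus> v \<otimes> y)"
    by (simp add: ring_norm)
  then have 1: "u \<otimes> ?c \<oplus> v \<otimes> ?d = p \<otimes> f \<oplus> q \<otimes> (u \<otimes> x \<oplus> v \<otimes> y)" by (simp add: uv)
  have 2: "\<alpha> \<otimes> ?d \<ominus> \<beta> \<otimes> ?c = p \<otimes> \<zero> \<oplus> q \<otimes> (\<alpha> \<otimes> y \<ominus> \<beta> \<otimes> x)"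
    by (simp add: ring_norm)
  have "unimodular {?c, ?d}" unfolding unimodular_def
  proof (intro allI impI notI)
    fix N assume N: "maximalideal N R" "{?c, ?d} \<subseteq> N"
    then have "u \<otimes> ?c \<oplus> v \<otimes> ?d \<in> N" "\<alpha> \<otimes> ?d \<ominus> \<beta> \<otimes> ?c \<in> N"
      by (simp_all add: maximalideal_iffs a_minus_def)
    with un N(1) show False unfolding 1 2 unimodular_def by simp
  qed
  then show ?thesis unfolding row_solvable_def by (intro bexI[of _ p] bexI[of _ q]) simp_all
qed

end

text \<open>Kaplansky's Hermite condition, expressed by cofactors: since
  \<open>s u + t v = 1\<close>, the matrix with columns \<open>(s, t)\<close> and
  \<open>(-v, u)\<close> has determinant 1 and takes the row \<open>(a, b)\<close> to
  \<open>(g, 0)\<close>.\<close>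

locale hermite_ring = cring +
  assumes hermite: "\<lbrakk>a \<in> carrier R; b \<in> carrier R\<rbrakk> \<Longrightarrow>
    \<exists>g\<in>carrier R. \<exists>u\<in>carrier R. \<exists>v\<in>carrier R. \<exists>s\<in>carrier R. \<exists>t\<in>carrier R.
      a = g \<otimes> u \<and> b = g \<otimes> v \<and> s \<otimes> u \<oplus> t \<otimes> v = \<one>"
begin

text \<open>
  One column operation turns the first row \<open>(a, b)\<close> into \<open>(f, 0)\<close>, and the second row into
  \<open>(x1, y1)\<close>. If \<open>y1 \<notin> M\<close>, add \<open>y1\<close> times the second row to the first one: at a maximal ideal not
  containing \<open>f\<close>, either \<open>y1\<close> is a unit or the new entry \<open>f + y1 x1\<close> is. If \<open>y1 \<in> M\<close>, then
  \<open>x1 \<notin> M\<close>, and the row operation replacing the first column by \<open>(gcd(f, x1), 0)\<close> does the job.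
\<close>

lemma row_solvable_step:
  assumes [simp]: "a \<in> carrier R" "b \<in> carrier R" "x \<in> carrier R" "y \<in> carrier R"
    and un: "unimodular {a, b, x, y}" and M: "maximalideal M R" and aM: "a \<in> M" "b \<in> M"
  obtains a' b' x' y' where "{a', b', x', y'} \<subseteq> carrier R" "unimodular {a', b', x', y'}"
    "\<not> {a', b'} \<subseteq> M"
    "\<And>N. maximalideal N R \<Longrightarrow> {a', b'} \<subseteq> N \<Longrightarrow> {a, b} \<subseteq> N"
    "row_solvable a' b' x' y' \<Longrightarrow> row_solvable a b x y"
proof -
  obtain f \<alpha> \<beta> u v where [simp]: "f \<in> carrier R" "\<alpha> \<in> carrier R" "\<beta> \<in> carrier R" "u \<in> carrier R" "v \<in> carrier R"
    and ab: "a = f \<otimes> \<alpha>" "b = f \<otimes> \<beta>" and uv: "u \<otimes> \<alpha> \<oplus> v \<otimes> \<beta> = \<one>"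
    using hermite[of a b] by auto
  define x1 y1 where "x1 = u \<otimes> x \<oplus> v \<otimes> y" and "y1 = \<alpha> \<otimes> y \<ominus> \<beta> \<otimes> x"
  have [simp]: "x1 \<in> carrier R" "y1 \<in> carrier R" by (simp_all add: x1_def y1_def)
  have solv: "row_solvable a b x y" if "row_solvable f \<zero> x1 y1"
    unfolding ab by (rule row_solvable_column_op[OF _ _ _ _ _ _ _ _ uv]) (use that in \<open>simp_all add: x1_def y1_def\<close>)
  have "f = u \<otimes> a \<oplus> v \<otimes> b"
  proof -
    have "u \<otimes> a \<oplus> v \<otimes> b = f \<otimes> (u \<otimes> \<alpha> \<oplus> v \<otimes> \<beta>)" by (simp add: ab ring_norm)
    then show ?thesis by (simp add: uv)
  qed
  then have fM: "f \<in> M" using M aM by (simp add: maximalideal_iffs)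
  have fN: "{a, b} \<subseteq> N" if "maximalideal N R" "f \<in> N" for N
    using that by (simp add: ab maximalideal_iffs)
  have un1: "\<not> (f \<in> N \<and> x1 \<in> N \<and> y1 \<in> N)" if N: "maximalideal N R" for N
  proof
    assume A: "f \<in> N \<and> x1 \<in> N \<and> y1 \<in> N"
    \<comment> \<open>The column operation has determinant 1; its inverse recovers \<open>x\<close>
      and \<open>y\<close> from \<open>x1\<close> and \<open>y1\<close>.\<close>
    have "\<alpha> \<otimes> x1 \<ominus> v \<otimes> y1 = x \<otimes> (u \<otimes> \<alpha> \<oplus> v \<otimes> \<beta>)" "\<beta> \<otimes> x1 \<oplus> u \<otimes> y1 = y \<otimes> (u \<otimes> \<alpha> \<oplus> v \<otimes> \<beta>)"
      unfolding x1_def y1_def by (simp_all add: ring_norm)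
    then have "x = \<alpha> \<otimes> x1 \<ominus> v \<otimes> y1" "y = \<beta> \<otimes> x1 \<oplus> u \<otimes> y1" by (simp_all add: uv)
    then have "x \<in> N" "y \<in> N" using A N by (simp_all add: maximalideal_iffs a_minus_def)
    then show False using fN[OF N] A N un by (simp add: unimodular_def)
  qed
  show thesis
  proof (cases "y1 \<in> M")
    case False
    show thesis
    proof (rule that[of "f \<oplus> y1 \<otimes> x1" "y1 \<otimes> y1" x1 y1])
      show "unimodular {f \<oplus> y1 \<otimes> x1, y1 \<otimes> y1, x1, y1}"
        unfolding unimodular_def using un1 by (auto simp: maximalideal_iffs)
      show "\<not> {f \<oplus> y1 \<otimes> x1, y1 \<otimes> y1} \<subseteq> M" using False M by (simp add: maximalideal_iffs)
      show "{a, b} \<subseteq> N" if "maximalideal N R" "{f \<oplus> y1 \<otimes> x1, y1 \<otimes> y1} \<subseteq> N" for N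
        using that fN by (auto simp: maximalideal_iffs)
      show "row_solvable a b x y" if "row_solvable (f \<oplus> y1 \<otimes> x1) (y1 \<otimes> y1) x1 y1"
        by (rule solv, rule row_solvable_row_op[of _ _ _ _ \<one> y1 \<zero> \<one>]) (use that in simp_all)
    qed simp
  next
    case True
    then have x1M: "x1 \<notin> M" using un1[OF M] fM by blast
    obtain e d z r s where [simp]: "e \<in> carrier R" "d \<in> carrier R" "z \<in> carrier R" "r \<in> carrier R" "s \<in> carrier R"
      and e: "f = e \<otimes> d" "x1 = e \<otimes> z" and rs: "r \<otimes> d \<oplus> s \<otimes> z = \<one>"
      using hermite[of f x1] by auto
    \<comment> \<open>The row operation with rows \<open>(r, s)\<close> and \<open>(-z, d)\<close>
      has determinant 1. It sends the first column \<open>(f, x1)\<close> to \<open>(e, 0)\<close>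
      and the second column \<open>(0, y1)\<close> to \<open>(s y1, d y1)\<close>.\<close>
    have "r \<otimes> f \<oplus> s \<otimes> x1 = e \<otimes> (r \<otimes> d \<oplus> s \<otimes> z)" by (simp add: e ring_norm)
    then have e1: "r \<otimes> f \<oplus> s \<otimes> x1 = e" by (simp add: rs)
    have e2: "\<ominus> z \<otimes> f \<oplus> d \<otimes> x1 = \<zero>" by (simp add: e ring_norm)
    show thesis
    proof (rule that[of e "s \<otimes> y1" \<zero> "d \<otimes> y1"])
      show "unimodular {e, s \<otimes> y1, \<zero>, d \<otimes> y1}" unfolding unimodular_def
      proof (intro allI impI notI)
        fix N assume N: "maximalideal N R" and sub: "{e, s \<otimes> y1, \<zero>, d \<otimes> y1} \<subseteq> N"
        then have "f \<in> N" "x1 \<in> N" by (simp_all add: e maximalideal_iffs)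
        then have "y1 \<notin> N" using un1 N by blast
        \<comment> \<open>As \<open>y1\<close> is outside the prime ideal \<open>N\<close>, both
          \<open>s\<close> and \<open>d\<close> are inside.\<close>
        then have "r \<otimes> d \<oplus> s \<otimes> z \<in> N" using N sub by (simp add: maximalideal_iffs)
        then show False using N by (simp add: rs maximalideal_iffs)
      qed
      show "\<not> {e, s \<otimes> y1} \<subseteq> M" using x1M M by (auto simp: e maximalideal_iffs)
      show "{a, b} \<subseteq> N" if "maximalideal N R" "{e, s \<otimes> y1} \<subseteq> N" for N
        by (rule fN) (use that in \<open>simp_all add: e maximalideal_iffs\<close>)
      show "row_solvable a b x y" if "row_solvable e (s \<otimes> y1) \<zero> (d \<otimes> y1)"
        by (rule solv, rule row_solvable_row_op[of _ _ _ _ r s "\<ominus> z" d]) (use that e1 e2 in simp_all)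
    qed simp
  qed
qed

text \<open>
  If the matrix were not solvable, iterating the previous lemma over an enumeration \<open>M\<close> of the maximal
  ideals containing \<open>a\<close> would give a decreasing sequence of nonempty closed sets of maximal ideals, the
  \<open>n\<close>-th of which avoids \<open>M (n - 1)\<close>. By compactness they have a common point, which is some \<open>M k\<close>.
\<close>

lemma row_solvable_if_countable:
  assumes a: "a \<in> carrier R" "b \<in> carrier R" "x \<in> carrier R" "y \<in> carrier R"
    and un: "unimodular {a, b, x, y}" and count: "countable {N. maximalideal N R \<and> a \<in> N}"
  shows "row_solvable a b x y"
proof (rule ccontr)
  assume unsolv: "\<not> row_solvable a b x y"
  \<comment> \<open>If no maximal ideal contains the first row, \<open>(1, 0)\<close> is a
    solution.\<close>
  have ex_max: "\<exists>N. maximalideal N R \<and> c \<in> N \<and> d \<in> N"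
    if "{c, d, z, w} \<subseteq> carrier R" "\<not> row_solvable c d z w" for c d z w
  proof (rule ccontr)
    assume "\<nexists>N. maximalideal N R \<and> c \<in> N \<and> d \<in> N"
    then have "unimodular {\<one> \<otimes> c \<oplus> \<zero> \<otimes> z, \<one> \<otimes> d \<oplus> \<zero> \<otimes> w}"
      using that(1) by (auto simp: unimodular_def)
    then show False using that(2) unfolding row_solvable_def by blast
  qed
  let ?V = "{N. maximalideal N R \<and> a \<in> N}"
  define M where "M = from_nat_into ?V"
  have V_ne: "?V \<noteq> {}" using ex_max[of a b x y] a unsolv by auto
  have M_max: "maximalideal (M n) R" for n
    using from_nat_into[OF V_ne, of n] by (simp add: M_def)
  have M_enum: "\<exists>n. M n = N" if "maximalideal N R" "a \<in> N" for N
    using from_nat_into_surj[OF count, of N] that by (auto simp: M_def)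
  \<comment> \<open>The last clause keeps every maximal ideal over the current first row inside the
    enumerated set; this will identify the limit ideal as some \<open>M k\<close>.\<close>
  define bad where "bad = (\<lambda>(c, d, z, w). {c, d, z, w} \<subseteq> carrier R \<and> unimodular {c, d, z, w}
    \<and> \<not> row_solvable c d z w \<and> (\<forall>N. maximalideal N R \<longrightarrow> {c, d} \<subseteq> N \<longrightarrow> a \<in> N))"
  define top where "top = (\<lambda>(c :: 'a, d :: 'a, z :: 'a, w :: 'a). {c, d})"
  have top_simp [simp]: "top (c, d, z, w) = {c, d}" for c d z w by (simp add: top_def)
  let ?next = "\<lambda>n s s'. (\<forall>N. maximalideal N R \<longrightarrow> top s' \<subseteq> N \<longrightarrow> top s \<subseteq> N) \<and> \<not> top s' \<subseteq> M n"
  have "\<exists>s. \<forall>n. bad (s n) \<and> ?next n (s n) (s (Suc n))"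
  proof (rule dependent_nat_choice)
    show "\<exists>s. bad s" using a un unsolv by (intro exI[of _ "(a, b, x, y)"]) (simp add: bad_def)
  next
    fix s n assume "bad s"
    moreover obtain c d z w where s: "s = (c, d, z, w)" by (cases s)
    ultimately have C: "c \<in> carrier R" "d \<in> carrier R" "z \<in> carrier R" "w \<in> carrier R"
      and U: "unimodular {c, d, z, w}" and S: "\<not> row_solvable c d z w"
      and A: "\<And>N. maximalideal N R \<Longrightarrow> {c, d} \<subseteq> N \<Longrightarrow> a \<in> N"
      by (simp_all add: bad_def)
    show "\<exists>s'. bad s' \<and> ?next n s s'"
    proof (cases "{c, d} \<subseteq> M n")
      case False
      then show ?thesis using \<open>bad s\<close> by (intro exI[of _ s]) (simp add: s)
    next
      case True
      then have cd: "c \<in> M n" "d \<in> M n" by auto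
      obtain c' d' z' w' where 1: "{c', d', z', w'} \<subseteq> carrier R" "unimodular {c', d', z', w'}"
        and 2: "\<not> {c', d'} \<subseteq> M n"
        and 3: "\<And>N. maximalideal N R \<Longrightarrow> {c', d'} \<subseteq> N \<Longrightarrow> {c, d} \<subseteq> N"
        and 4: "row_solvable c' d' z' w' \<Longrightarrow> row_solvable c d z w"
        using row_solvable_step[OF C U M_max cd] by metis
      have "\<not> row_solvable c' d' z' w'" using 4 S by blast
      then have "bad (c', d', z', w')" using 1 3 A by (simp add: bad_def)
      moreover have "?next n s (c', d', z', w')" unfolding s top_simp using 2 3 by simp
      ultimately show ?thesis by blast
    qed
  qed
  then obtain s where bad: "\<And>n. bad (s n)" and next_s: "\<And>n. ?next n (s n) (s (Suc n))" by blast
  have top_carr: "top (s n) \<subseteq> carrier R" for n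
    using bad[of n] by (cases "s n") (simp add: bad_def)
  \<comment> \<open>Inclusions between sets of maximal ideals do not compare the ideals generated by
    the rows. The intersections of all maximal ideals over the rows, however, increase as these sets
    shrink.\<close>
  define J where "J n = {r \<in> carrier R. \<forall>N. maximalideal N R \<longrightarrow> top (s n) \<subseteq> N \<longrightarrow> r \<in> N}" for n
  have J_ideal: "ideal (J n) R" for n
  proof (rule idealI)
    show "ring R" by (rule ring_axioms)
    show "subgroup (J n) (add_monoid R)"
      by (rule subgroup.intro)
        (auto simp: J_def maximalideal_add maximalideal_zero maximalideal_minus_iff simp flip: a_inv_def)
  qed (auto simp: J_def maximalideal_iffs)
  have J_mono: "J m \<subseteq> J n" if "m \<le> n" for m n
    by (rule lift_Suc_mono_le[OF _ that]) (use next_s in \<open>auto simp: J_def\<close>)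
  have J_one: "\<one> \<notin> J n" for n
  proof -
    obtain c d z w where s: "s n = (c, d, z, w)" by (cases "s n")
    then obtain N where "maximalideal N R" "top (s n) \<subseteq> N"
      using ex_max[of c d z w] bad[of n] by (auto simp: bad_def)
    then show ?thesis using maximalideal_one by (auto simp: J_def)
  qed
  \<comment> \<open>Compactness: if 1 were in the union, it would be in a single
    \<open>J n\<close>.\<close>
  have "ideal (\<Union>(range J)) R"
  proof (rule ideal_directed_Union)
    fix K L assume "K \<in> range J" "L \<in> range J"
    then obtain m n where "K = J m" "L = J n" by auto
    then have "K \<union> L \<subseteq> J (max m n)" using J_mono[of m "max m n"] J_mono[of n "max m n"] by simp
    then show "\<exists>I\<in>range J. K \<union> L \<subseteq> I" by blast
  qed (use J_ideal in auto)
  then obtain N where N: "maximalideal N R" "(\<Union>n. J n) \<subseteq> N"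
    using exists_maximalideal[of "\<Union>n. J n"] J_one by blast
  have top_N: "top (s n) \<subseteq> N" for n
    using N(2) top_carr[of n] by (auto simp: J_def)
  have "a \<in> N" using bad[of 0] top_N[of 0] N(1) by (cases "s 0") (simp add: bad_def)
  then obtain k where "M k = N" using M_enum N(1) by blast
  then show False using next_s[of k] top_N[of "Suc k"] by blast
qed

end

section \<open>Rings whose annihilators are generated by idempotents\<close>

text \<open>The last two conditions say that \<open>f\<close> generates the annihilator of
  \<open>a\<close>. This is equivalent to projectivity of the principal ideals, whence the
  name.\<close>

locale pp_ring = cring +
  assumes annihilator_idempotent: "a \<in> carrier R \<Longrightarrow>
    \<exists>f\<in>carrier R. f \<otimes> f = f \<and> f \<otimes> a = \<zero> \<and> (\<forall>r\<in>carrier R. r \<otimes> a = \<zero> \<longrightarrow> r \<otimes> f = r)"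

locale countable_pp_hermite_ring = pp_ring + hermite_ring +
  assumes countable_character: "countable_character R"
begin

text \<open>
  With \<open>f\<close> the idempotent generating the annihilator of \<open>d\<close>, the element \<open>d + f\<close> is not a zero divisor.
  A solution for \<open>d + f\<close> is used on the factor \<open>(1 - f)R\<close>, and the row \<open>(0, 1)\<close> on the factor \<open>fR\<close>.
\<close>

lemma row_solvable_triangular:
  assumes [simp]: "d \<in> carrier R" "x \<in> carrier R" "y \<in> carrier R"
    and un: "unimodular {d, x, y}"
  shows "row_solvable d \<zero> x y"
proof -
  obtain f where [simp]: "f \<in> carrier R" and f: "f \<otimes> f = f" "f \<otimes> d = \<zero>"
    and ann: "\<And>r. r \<in> carrier R \<Longrightarrow> r \<otimes> d = \<zero> \<Longrightarrow> r \<otimes> f = r"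
    using annihilator_idempotent[of d] by auto
  have fd_N: "f \<in> N \<or> d \<in> N" if "maximalideal N R" for N
    using maximalideal_mult_iff[of N f d] that by (simp add: f maximalideal_zero)
  have f1_N: "f \<in> N \<longleftrightarrow> \<one> \<ominus> f \<notin> N" if N: "maximalideal N R" for N
  proof -
    have "f \<otimes> (\<one> \<ominus> f) = \<zero>" "f \<oplus> (\<one> \<ominus> f) = \<one>" by (simp_all add: ring_norm f)
    then show ?thesis using maximalideal_mult_iff[of N f "\<one> \<ominus> f"] maximalideal_add[of N f "\<one> \<ominus> f"] N
      by (auto simp: maximalideal_zero maximalideal_one)
  qed
  have "non_zero_divisor R (d \<oplus> f)" unfolding non_zero_divisor_def
  proof (intro conjI ballI impI)
    fix b assume b [simp]: "b \<in> carrier R" and 0: "(d \<oplus> f) \<otimes> b = \<zero>"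
    \<comment> \<open>Multiplication by \<open>f\<close> isolates \<open>f b = 0\<close>. Then
      \<open>d b = 0\<close> as well, so \<open>b\<close> annihilates \<open>d\<close> and
      \<open>b = b f = 0\<close>.\<close>
    have "f \<otimes> ((d \<oplus> f) \<otimes> b) = (f \<otimes> d) \<otimes> b \<oplus> (f \<otimes> f) \<otimes> b" by (simp only: ring_norm assms b \<open>f \<in> carrier R\<close>)
    then have fb: "f \<otimes> b = \<zero>" by (simp add: 0 f)
    have "d \<otimes> b \<oplus> f \<otimes> b = \<zero>" using 0 by (simp add: l_distr)
    then have "b \<otimes> d = \<zero>" using fb by (simp add: m_comm)
    then show "b = \<zero>" using ann[of b] fb by (simp add: m_comm)
  qed simp
  then have "countable {N. maximalideal N R \<and> d \<oplus> f \<in> N}"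
    using countable_character by (simp add: countable_character_def)
  moreover have "unimodular {d \<oplus> f, \<zero>, x, y}"
    unfolding unimodular_def
  proof (intro allI impI notI)
    fix N assume N: "maximalideal N R" and sub: "{d \<oplus> f, \<zero>, x, y} \<subseteq> N"
    then have "d \<in> N" using fd_N[OF N] maximalideal_add_iff(2)[OF N, of f d] by auto
    then show False using un N sub by (auto simp: unimodular_def)
  qed
  ultimately have "row_solvable (d \<oplus> f) \<zero> x y"
    by (intro row_solvable_if_countable) simp_all
  then obtain p q where [simp]: "p \<in> carrier R" "q \<in> carrier R"
    and pq: "unimodular {p \<otimes> (d \<oplus> f) \<oplus> q \<otimes> x, p \<otimes> \<zero> \<oplus> q \<otimes> y}"
    unfolding row_solvable_def by blast
  let ?g = "\<one> \<ominus> f"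
  have un': "unimodular {(?g \<otimes> p) \<otimes> d \<oplus> (?g \<otimes> q \<oplus> f) \<otimes> x, (?g \<otimes> p) \<otimes> \<zero> \<oplus> (?g \<otimes> q \<oplus> f) \<otimes> y}"
    unfolding unimodular_def
  proof (intro allI impI notI)
    fix N assume N: "maximalideal N R"
      and sub: "{(?g \<otimes> p) \<otimes> d \<oplus> (?g \<otimes> q \<oplus> f) \<otimes> x, (?g \<otimes> p) \<otimes> \<zero> \<oplus> (?g \<otimes> q \<oplus> f) \<otimes> y} \<subseteq> N"
    show False
    proof (cases "f \<in> N")
      case True
      then have g: "?g \<notin> N" using f1_N N by blast
      \<comment> \<open>Here \<open>f\<close> is in \<open>N\<close>, and up to multiples of
        \<open>f\<close> the glued row is \<open>?g\<close> times the row solving the problem for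
        \<open>d + f\<close>.\<close>
      have "?g \<otimes> p \<otimes> d \<oplus> (?g \<otimes> q \<oplus> f) \<otimes> x \<oplus> (?g \<otimes> p \<otimes> f \<ominus> f \<otimes> x) = ?g \<otimes> (p \<otimes> (d \<oplus> f) \<oplus> q \<otimes> x)"
        "?g \<otimes> p \<otimes> \<zero> \<oplus> (?g \<otimes> q \<oplus> f) \<otimes> y \<oplus> \<ominus> (f \<otimes> y) = ?g \<otimes> (p \<otimes> \<zero> \<oplus> q \<otimes> y)"
        by (simp_all add: ring_norm)
      moreover have "?g \<otimes> p \<otimes> d \<oplus> (?g \<otimes> q \<oplus> f) \<otimes> x \<oplus> (?g \<otimes> p \<otimes> f \<ominus> f \<otimes> x) \<in> N"
        "?g \<otimes> p \<otimes> \<zero> \<oplus> (?g \<otimes> q \<oplus> f) \<otimes> y \<oplus> \<ominus> (f \<otimes> y) \<in> N"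
        by (rule maximalideal_add[OF N]; use sub True N in \<open>simp add: maximalideal_iffs a_minus_def\<close>)+
      ultimately show False using g N pq by (simp add: unimodular_def maximalideal_mult_iff)
    next
      case False
      then have g: "?g \<in> N" and d: "d \<in> N" using f1_N fd_N N by blast+
      \<comment> \<open>Here \<open>?g\<close> is in \<open>N\<close>, so modulo \<open>N\<close>
        the glued row is \<open>f\<close> times \<open>(x, y)\<close>.\<close>
      have "f \<otimes> z \<in> N" if "?g \<otimes> w \<oplus> (?g \<otimes> q \<oplus> f) \<otimes> z \<in> N" and [simp]: "z \<in> carrier R" "w \<in> carrier R" for z w
      proof -
        have "?g \<otimes> w \<oplus> (?g \<otimes> q \<oplus> f) \<otimes> z = ?g \<otimes> (w \<oplus> q \<otimes> z) \<oplus> f \<otimes> z" by (simp add: ring_norm)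
        then show ?thesis using that(1) g N by (simp add: maximalideal_iffs)
      qed
      from this[of "p \<otimes> d" x] this[of "p \<otimes> \<zero>" y] have "f \<otimes> x \<in> N" "f \<otimes> y \<in> N"
        using sub by (simp_all add: m_assoc)
      then show False using un d False N by (simp add: unimodular_def maximalideal_mult_iff)
    qed
  qed
  show ?thesis unfolding row_solvable_def
    by (rule bexI[of _ "?g \<otimes> p"], rule bexI[of _ "?g \<otimes> q \<oplus> f"], rule un') simp_all
qed

end

section \<open>Idempotent annihilators and coprime cofactors from the hypotheses\<close>

context cring
begin

text \<open>
  A splitting \<open>h\<close> of the surjection \<open>R \<rightarrow> aR\<close> yields the idempotent \<open>1 - h(a)\<close>.
\<close>

lemma semihereditary_annihilator_idempotent:
  assumes "semihereditary R" and a [simp]: "a \<in> carrier R"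
  shows "\<exists>f\<in>carrier R. f \<otimes> f = f \<and> f \<otimes> a = \<zero> \<and> (\<forall>r\<in>carrier R. r \<otimes> a = \<zero> \<longrightarrow> r \<otimes> f = r)"
proof -
  let ?I = "PIdl a" and ?P = "ideal_module R (PIdl a)" and ?M = "ideal_module R (carrier R)"
  have P: "projective_module R ?P"
    using assms by (auto simp: semihereditary_def cgenideal_eq_genideal)
  have "\<exists>h \<in> LinearCombinations.module_hom R ?P ?M. \<forall>x \<in> carrier ?P. h x \<otimes> a = x"
  proof (rule projective_module_lift[OF P])
    show "Module.module R ?M" by (rule module_ideal_module[OF oneideal])
    show "Module.module R ?P" by (rule module_ideal_module[OF cgenideal_ideal[OF a]])
    show "(\<lambda>r. r \<otimes> a) \<in> LinearCombinations.module_hom R ?M ?P"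
      by (auto simp: LinearCombinations.module_hom_def ideal_module_def cgenideal_def l_distr m_assoc)
    show "(\<lambda>r. r \<otimes> a) ` carrier ?M = carrier ?P"
      by (auto simp: ideal_module_def cgenideal_def)
    show "(\<lambda>x. x) \<in> LinearCombinations.module_hom R ?P ?P"
      by (auto simp: LinearCombinations.module_hom_def)
  qed
  then obtain h where h: "h \<in> LinearCombinations.module_hom R ?P ?M"
    and ha: "\<And>x. x \<in> ?I \<Longrightarrow> h x \<otimes> a = x" by (auto simp: ideal_module_def)
  have aI: "a \<in> ?I" by (rule cgenideal_self[OF a])
  have ha_carr [simp]: "h a \<in> carrier R"
    using LinearCombinations.module_hom_closed[OF h] aI by (auto simp: ideal_module_def)
  have h_smult: "r \<otimes> h a = h (r \<otimes> a)" if "r \<in> carrier R" for r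
    using LinearCombinations.module_hom_smult[OF h that, of a] aI by (simp add: ideal_module_def)
  have h0: "h \<zero> = \<zero>" using h_smult[of \<zero>] by simp
  \<comment> \<open>By linearity, \<open>r h(a) = h(r a) = 0\<close>.\<close>
  have ann: "r \<otimes> (\<one> \<ominus> h a) = r" if "r \<in> carrier R" "r \<otimes> a = \<zero>" for r
    using h_smult[of r] that h0 by (simp add: ring_norm)
  have "(\<one> \<ominus> h a) \<otimes> a = a \<ominus> h a \<otimes> a" by (simp add: ring_norm)
  then have 0: "(\<one> \<ominus> h a) \<otimes> a = \<zero>" by (simp add: ha aI a_minus_def r_neg)
  show ?thesis
    \<comment> \<open>Idempotency is the instance of \<open>ann\<close> in which \<open>r\<close> is
      \<open>1 - h a\<close> itself.\<close>
    by (rule bexI[of _ "\<one> \<ominus> h a"]) (use ann 0 in simp_all)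
qed

lemma bezout_generator:
  assumes "bezout_ring R" and [simp]: "a \<in> carrier R" "b \<in> carrier R"
  obtains g u v s t where "{g, u, v, s, t} \<subseteq> carrier R" "a = g \<otimes> u" "b = g \<otimes> v"
    "g = s \<otimes> a \<oplus> t \<otimes> b"
proof -
  have pr: "principalideal (Idl {a, b}) R" using assms by (simp add: bezout_ring_def)
  obtain g where g [simp]: "g \<in> carrier R" and eq: "Idl {a, b} = PIdl g"
    using principalideal.generate[OF pr] by (auto simp: cgenideal_eq_genideal)
  have "{a, b} \<subseteq> PIdl g" using genideal_self[of "{a, b}"] eq by simp
  then obtain u v where uv: "u \<in> carrier R" "v \<in> carrier R" "a = u \<otimes> g" "b = v \<otimes> g"
    by (auto simp: cgenideal_def)
  have "PIdl a \<union> PIdl b \<subseteq> carrier R" by (auto simp: cgenideal_def)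
  moreover have "{a, b} \<subseteq> PIdl a \<union> PIdl b" using cgenideal_self[of a] cgenideal_self[of b] by simp
  ultimately have "Idl {a, b} \<subseteq> Idl (PIdl a \<union> PIdl b)" by (rule subset_Idl_subset)
  also have "\<dots> = PIdl a <+>\<^bsub>R\<^esub> PIdl b" by (intro union_genideal cgenideal_ideal) simp_all
  finally have "Idl {a, b} \<subseteq> PIdl a <+>\<^bsub>R\<^esub> PIdl b" .
  then have "g \<in> PIdl a <+>\<^bsub>R\<^esub> PIdl b" using eq cgenideal_self[OF g] by auto
  then obtain s t where st: "s \<in> carrier R" "t \<in> carrier R" "g = s \<otimes> a \<oplus> t \<otimes> b"
    by (auto simp: set_add_defs cgenideal_def)
  show thesis
  proof (rule that[OF _ _ _ st(3)])
    show "{g, u, v, s, t} \<subseteq> carrier R" using uv(1,2) st(1,2) by simp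
    show "a = g \<otimes> u" "b = g \<otimes> v" using uv m_comm[OF g] by metis+
  qed
qed

end

text \<open>The identity \<open>g = (s u + t v) g\<close> only says that
  \<open>1 - (s u + t v)\<close> annihilates \<open>g\<close>. If the idempotent \<open>f\<close>
  generates this annihilator, then \<open>s u + t v = 1\<close> holds on the factor
  \<open>(1 - f)R\<close>, where everything is kept. On \<open>fR\<close> the element
  \<open>g\<close> vanishes, so cofactors are free there: both \<open>(u, v)\<close> and
  \<open>(s, t)\<close> are replaced by \<open>(1, 0)\<close>.\<close>

lemma (in pp_ring) bezout_hermite:
  assumes "bezout_ring R" and [simp]: "a \<in> carrier R" "b \<in> carrier R"
  shows "\<exists>g\<in>carrier R. \<exists>u\<in>carrier R. \<exists>v\<in>carrier R. \<exists>s\<in>carrier R. \<exists>t\<in>carrier R.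
    a = g \<otimes> u \<and> b = g \<otimes> v \<and> s \<otimes> u \<oplus> t \<otimes> v = \<one>"
proof -
  obtain g u v s t where carr: "{g, u, v, s, t} \<subseteq> carrier R" and ab: "a = g \<otimes> u" "b = g \<otimes> v"
    and g: "g = s \<otimes> a \<oplus> t \<otimes> b"
    by (rule bezout_generator[OF assms])
  have [simp]: "g \<in> carrier R" "u \<in> carrier R" "v \<in> carrier R" "s \<in> carrier R" "t \<in> carrier R"
    using carr by auto
  obtain f where [simp]: "f \<in> carrier R" and f: "f \<otimes> f = f" "f \<otimes> g = \<zero>"
    and ann: "\<And>r. r \<in> carrier R \<Longrightarrow> r \<otimes> g = \<zero> \<Longrightarrow> r \<otimes> f = r"
    using annihilator_idempotent[OF \<open>g \<in> carrier R\<close>] by metis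
  let ?r = "\<one> \<ominus> (s \<otimes> u \<oplus> t \<otimes> v)" and ?e = "\<one> \<ominus> f"
  have "s \<otimes> (g \<otimes> u) \<oplus> t \<otimes> (g \<otimes> v) = (s \<otimes> u \<oplus> t \<otimes> v) \<otimes> g" by (simp add: ring_norm)
  then have "(s \<otimes> u \<oplus> t \<otimes> v) \<otimes> g = g" using g unfolding ab by (rule trans[OF sym sym])
  moreover have "?r \<otimes> g = g \<ominus> (s \<otimes> u \<oplus> t \<otimes> v) \<otimes> g"
    by (simp add: ring_norm)
  ultimately have "?r \<otimes> g = \<zero>" by (simp add: a_minus_def r_neg)
  then have r: "?r \<otimes> f = ?r" by (simp add: ann)
  have e: "?e \<otimes> f = \<zero>" by (simp add: ring_norm f)
  have ee: "?e \<otimes> ?e = ?e" by (simp add: ring_norm f)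
  have ge: "g \<otimes> ?e = g"
  proof -
    have "g \<otimes> ?e = g \<ominus> f \<otimes> g" by (simp add: ring_norm)
    then show ?thesis by (simp add: f a_minus_def)
  qed
  let ?u = "?e \<otimes> u \<oplus> f" and ?v = "?e \<otimes> v" and ?s = "?e \<otimes> s \<oplus> f" and ?t = "?e \<otimes> t"
  have fg: "g \<otimes> f = \<zero>" using f by (simp add: m_comm)
  have "g \<otimes> ?u = (g \<otimes> ?e) \<otimes> u \<oplus> g \<otimes> f" "g \<otimes> ?v = (g \<otimes> ?e) \<otimes> v" by (simp_all add: r_distr m_assoc)
  then have "a = g \<otimes> ?u" "b = g \<otimes> ?v" using ab by (simp_all add: ge fg)
  moreover have "?s \<otimes> ?u \<oplus> ?t \<otimes> ?v = \<one>"
  proof -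
    define w e where "w = s \<otimes> u \<oplus> t \<otimes> v" and "e = \<one> \<ominus> f"
    have [simp]: "w \<in> carrier R" "e \<in> carrier R" by (simp_all add: w_def e_def)
    \<comment> \<open>By \<open>r\<close>, the defect \<open>1 - w\<close> is a multiple of
      \<open>f\<close>, which \<open>e\<close> kills.\<close>
    have "e \<otimes> (\<one> \<ominus> w) = e \<otimes> ((\<one> \<ominus> w) \<otimes> f)" using r by (simp add: w_def)
    also have "\<dots> = (e \<otimes> f) \<otimes> (\<one> \<ominus> w)" by (simp add: m_assoc m_comm)
    also have "\<dots> = \<zero>" using e by (simp add: e_def)
    finally have "e \<ominus> e \<otimes> w = \<zero>" by (simp add: ring_norm)
    then have ew: "e \<otimes> w = e" by simp
    have "(e \<otimes> s \<oplus> f) \<otimes> (e \<otimes> u \<oplus> f) \<oplus> (e \<otimes> t) \<otimes> (e \<otimes> v)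
        = (e \<otimes> e) \<otimes> w \<oplus> (e \<otimes> f) \<otimes> (s \<oplus> u) \<oplus> f \<otimes> f"
      by (simp add: w_def ring_norm)
    also have "\<dots> = e \<oplus> f" using e ee by (simp add: e_def[symmetric] f ew)
    also have "\<dots> = \<one>" by (simp add: e_def ring_norm)
    finally show ?thesis by (simp add: e_def)
  qed
  ultimately have "a = g \<otimes> ?u \<and> b = g \<otimes> ?v \<and> ?s \<otimes> ?u \<oplus> ?t \<otimes> ?v = \<one>" by blast
  then show ?thesis
    by - (rule bexI[of _ g], rule bexI[of _ ?u], rule bexI[of _ ?v], rule bexI[of _ ?s],
      rule bexI[of _ ?t], assumption, simp_all only: a_closed m_closed minus_closed one_closed
      \<open>g \<in> carrier R\<close> \<open>u \<in> carrier R\<close> \<open>v \<in> carrier R\<close> \<open>s \<in> carrier R\<close> \<open>t \<in> carrier R\<close> \<open>f \<in> carrier R\<close>)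
qed

section \<open>Unimodular families\<close>

lemma (in cring) maximalideal_finsum:
  assumes N: "maximalideal N R" and f: "\<And>i. i \<in> I \<Longrightarrow> f i \<in> N"
  shows "finsum R f I \<in> N"
proof -
  interpret N: maximalideal N R by fact
  show ?thesis using f
  proof (induction I rule: infinite_finite_induct)
    case (insert i I)
    have "f \<in> insert i I \<rightarrow> carrier R" using insert.prems N.Icarr by auto
    then show ?case using insert by (simp add: Pi_def N.a_closed)
  qed (auto simp: N.zero_closed)
qed

text \<open>The two-element condition is applied to \<open>v i\<close> and the gcd \<open>g\<close>
  of the rest. The old cofactors are multiplied by \<open>b\<close> and the old coefficients by
  \<open>q\<close>, so the new sum is \<open>p a + q b\<close>.\<close>

lemma (in hermite_ring) hermite_family:
  assumes "finite I" "I \<noteq> {}" "v \<in> I \<rightarrow> carrier R"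
  shows "\<exists>g\<in>carrier R. \<exists>w\<in>I \<rightarrow> carrier R. \<exists>s\<in>I \<rightarrow> carrier R.
    (\<forall>i\<in>I. v i = g \<otimes> w i) \<and> (\<Oplus>i\<in>I. s i \<otimes> w i) = \<one>"
  using assms
proof (induction I rule: finite_ne_induct)
  case (singleton i)
  then show ?case
    by (intro bexI[where x = "v i"] bexI[where x = "\<lambda>_. \<one>"]) auto
next
  case (insert i I)
  have v: "v i \<in> carrier R" "v \<in> I \<rightarrow> carrier R" using insert.prems by auto
  obtain g w s where [simp]: "g \<in> carrier R" and w: "w \<in> I \<rightarrow> carrier R" and s: "s \<in> I \<rightarrow> carrier R"
    and vw: "\<And>j. j \<in> I \<Longrightarrow> v j = g \<otimes> w j" and sw: "(\<Oplus>j\<in>I. s j \<otimes> w j) = \<one>"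
    using insert.IH[OF v(2)] by auto
  obtain h a b p q where [simp]: "h \<in> carrier R" "a \<in> carrier R" "b \<in> carrier R" "p \<in> carrier R" "q \<in> carrier R"
    and h: "v i = h \<otimes> a" "g = h \<otimes> b" and pq: "p \<otimes> a \<oplus> q \<otimes> b = \<one>"
    using hermite[OF v(1), of g] by auto
  have [simp]: "w j \<in> carrier R" "s j \<in> carrier R" if "j \<in> I" for j using w s that by auto
  let ?w = "\<lambda>j. if j = i then a else b \<otimes> w j" and ?s = "\<lambda>j. if j = i then p else q \<otimes> s j"
  have carr: "?w \<in> insert i I \<rightarrow> carrier R" "?s \<in> insert i I \<rightarrow> carrier R" by auto
  have "v j = h \<otimes> ?w j" if "j \<in> insert i I" for j
    using that h vw[of j] by (auto simp: m_assoc)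
  moreover have "(\<Oplus>j\<in>insert i I. ?s j \<otimes> ?w j) = \<one>"
  proof -
    have "(\<Oplus>j\<in>insert i I. ?s j \<otimes> ?w j) = p \<otimes> a \<oplus> (\<Oplus>j\<in>I. ?s j \<otimes> ?w j)"
      using insert.hyps by (subst finsum_insert) auto
    also have "(\<Oplus>j\<in>I. ?s j \<otimes> ?w j) = (\<Oplus>j\<in>I. (q \<otimes> b) \<otimes> (s j \<otimes> w j))"
      using insert.hyps by (intro finsum_cong') (auto simp: m_ac)
    also have "\<dots> = (q \<otimes> b) \<otimes> (\<Oplus>j\<in>I. s j \<otimes> w j)"
      using insert.hyps by (intro finsum_rdistr[symmetric]) auto
    finally show ?thesis using pq by (simp add: sw)
  qed
  ultimately have "(\<forall>j\<in>insert i I. v j = h \<otimes> ?w j) \<and> (\<Oplus>j\<in>insert i I. ?s j \<otimes> ?w j) = \<one>" by blast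
  then show ?case
    by - (rule bexI[of _ h], rule bexI[of _ ?w], rule bexI[of _ ?s], (assumption | rule carr | simp)+)
qed

context countable_pp_hermite_ring
begin

text \<open>
  Write \<open>u = d u'\<close> and \<open>v = x u' + y w\<close> with \<open>u'\<close> and \<open>w\<close> unimodular, and solve the problem for the
  triangular matrix with rows \<open>(d, 0)\<close> and \<open>(x, y)\<close>.
\<close>

lemma unimodular_two_vectors:
  assumes I: "finite I" "I \<noteq> {}" and u: "u \<in> I \<rightarrow> carrier R" and v: "v \<in> I \<rightarrow> carrier R"
    and un: "unimodular (u ` I \<union> v ` I)"
  shows "\<exists>p\<in>carrier R. \<exists>q\<in>carrier R. unimodular ((\<lambda>i. p \<otimes> u i \<oplus> q \<otimes> v i) ` I)"
proof -
  obtain d u' s where [simp]: "d \<in> carrier R" and u': "u' \<in> I \<rightarrow> carrier R" and s: "s \<in> I \<rightarrow> carrier R"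
    and du: "\<And>i. i \<in> I \<Longrightarrow> u i = d \<otimes> u' i" and su: "(\<Oplus>i\<in>I. s i \<otimes> u' i) = \<one>"
    using hermite_family[OF I u] by auto
  have [simp]: "u' i \<in> carrier R" "s i \<in> carrier R" "v i \<in> carrier R" if "i \<in> I" for i
    using that u' s v by auto
  \<comment> \<open>This choice makes the pairing of \<open>s\<close> with \<open>v - x u'\<close>
    vanish, so that \<open>s\<close> later reads off the coefficient of \<open>u'\<close>.\<close>
  define x where "x = (\<Oplus>i\<in>I. s i \<otimes> v i)"
  have [simp]: "x \<in> carrier R" unfolding x_def by (intro finsum_closed) auto
  have vx: "(\<lambda>i. v i \<ominus> x \<otimes> u' i) \<in> I \<rightarrow> carrier R" by auto
  obtain y w t where [simp]: "y \<in> carrier R" and w: "w \<in> I \<rightarrow> carrier R" and t: "t \<in> I \<rightarrow> carrier R"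
    and yw: "\<And>i. i \<in> I \<Longrightarrow> v i \<ominus> x \<otimes> u' i = y \<otimes> w i" and tw: "(\<Oplus>i\<in>I. t i \<otimes> w i) = \<one>"
    using hermite_family[OF I vx] by auto
  have [simp]: "w i \<in> carrier R" "t i \<in> carrier R" if "i \<in> I" for i using that w t by auto
  have v_eq: "v i = x \<otimes> u' i \<oplus> y \<otimes> w i" if i: "i \<in> I" for i
    using i by (simp flip: yw add: ring_norm)
  have "unimodular {d, x, y}" unfolding unimodular_def
  proof (intro allI impI notI)
    fix N assume N: "maximalideal N R" "{d, x, y} \<subseteq> N"
    have "u i \<in> N \<and> v i \<in> N" if "i \<in> I" for i
      unfolding du[OF that] v_eq[OF that] using N that by (simp add: maximalideal_iffs)
    then show False using un N(1) by (auto simp: unimodular_def)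
  qed
  then obtain p q where [simp]: "p \<in> carrier R" "q \<in> carrier R"
    and pq: "unimodular {p \<otimes> d \<oplus> q \<otimes> x, p \<otimes> \<zero> \<oplus> q \<otimes> y}"
    using row_solvable_triangular[of d x y] unfolding row_solvable_def by auto
  define c where "c = p \<otimes> d \<oplus> q \<otimes> x"
  have [simp]: "c \<in> carrier R" by (simp add: c_def)
  have sw: "(\<Oplus>i\<in>I. s i \<otimes> (y \<otimes> w i)) = \<zero>"
  proof -
    have "(\<Oplus>i\<in>I. s i \<otimes> (y \<otimes> w i)) = (\<Oplus>i\<in>I. s i \<otimes> v i \<oplus> \<ominus> x \<otimes> (s i \<otimes> u' i))"
      by (rule finsum_cong') (auto simp: ring_norm simp flip: yw)
    also have "\<dots> = x \<oplus> (\<Oplus>i\<in>I. \<ominus> x \<otimes> (s i \<otimes> u' i))"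
      unfolding x_def by (rule finsum_addf) auto
    also have "(\<Oplus>i\<in>I. \<ominus> x \<otimes> (s i \<otimes> u' i)) = \<ominus> x \<otimes> (\<Oplus>i\<in>I. s i \<otimes> u' i)"
      by (rule finsum_rdistr[symmetric]) (use I in auto)
    finally show ?thesis by (simp add: su r_neg)
  qed
  have comb: "p \<otimes> u i \<oplus> q \<otimes> v i = c \<otimes> u' i \<oplus> q \<otimes> (y \<otimes> w i)" if "i \<in> I" for i
    unfolding c_def du[OF that] v_eq[OF that] using that by (simp add: ring_norm)
  have "unimodular ((\<lambda>i. p \<otimes> u i \<oplus> q \<otimes> v i) ` I)" unfolding unimodular_def
  proof (intro allI impI notI)
    fix N assume N: "maximalideal N R" and sub: "(\<lambda>i. p \<otimes> u i \<oplus> q \<otimes> v i) ` I \<subseteq> N"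
    have z: "c \<otimes> u' i \<oplus> q \<otimes> (y \<otimes> w i) \<in> N" if "i \<in> I" for i
      using sub comb that by auto
    \<comment> \<open>Pairing the family with \<open>s\<close> isolates \<open>c\<close>; pairing
      what is left with \<open>t\<close> isolates \<open>q y\<close>.\<close>
    have "(\<Oplus>i\<in>I. s i \<otimes> (c \<otimes> u' i \<oplus> q \<otimes> (y \<otimes> w i))) \<in> N"
      by (rule maximalideal_finsum[OF N]) (use z N in \<open>simp add: maximalideal_mult_iff\<close>)
    also have "(\<Oplus>i\<in>I. s i \<otimes> (c \<otimes> u' i \<oplus> q \<otimes> (y \<otimes> w i)))
        = (\<Oplus>i\<in>I. c \<otimes> (s i \<otimes> u' i) \<oplus> q \<otimes> (s i \<otimes> (y \<otimes> w i)))"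
      by (rule finsum_cong') (auto simp: ring_norm)
    also have "\<dots> = (\<Oplus>i\<in>I. c \<otimes> (s i \<otimes> u' i)) \<oplus> (\<Oplus>i\<in>I. q \<otimes> (s i \<otimes> (y \<otimes> w i)))"
      by (rule finsum_addf) auto
    also have "(\<Oplus>i\<in>I. c \<otimes> (s i \<otimes> u' i)) = c \<otimes> (\<Oplus>i\<in>I. s i \<otimes> u' i)"
      by (rule finsum_rdistr[symmetric]) (use I in auto)
    also have "(\<Oplus>i\<in>I. q \<otimes> (s i \<otimes> (y \<otimes> w i))) = q \<otimes> (\<Oplus>i\<in>I. s i \<otimes> (y \<otimes> w i))"
      by (rule finsum_rdistr[symmetric]) (use I in auto)
    finally have c: "c \<in> N" by (simp add: su sw)
    have "q \<otimes> (y \<otimes> w i) \<in> N" if "i \<in> I" for i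
      using z[OF that] c N that by (simp add: maximalideal_iffs)
    then have "(\<Oplus>i\<in>I. t i \<otimes> (q \<otimes> (y \<otimes> w i))) \<in> N"
      by (intro maximalideal_finsum[OF N]) (use N in \<open>simp add: maximalideal_mult_iff\<close>)
    also have "(\<Oplus>i\<in>I. t i \<otimes> (q \<otimes> (y \<otimes> w i))) = (\<Oplus>i\<in>I. (q \<otimes> y) \<otimes> (t i \<otimes> w i))"
      by (rule finsum_cong') (auto simp: m_ac)
    also have "\<dots> = (q \<otimes> y) \<otimes> (\<Oplus>i\<in>I. t i \<otimes> w i)"
      by (rule finsum_rdistr[symmetric]) (use I in auto)
    finally have "q \<otimes> y \<in> N" by (simp add: tw)
    then show False using pq c N by (simp add: unimodular_def c_def)
  qed
  then show ?thesis by - (rule bexI[of _ p], rule bexI[of _ q], assumption, simp_all)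
qed

text \<open>Induction on the columns. The columns other than \<open>j\<close> have the form
  \<open>g B\<close> with unimodular \<open>B\<close>, and some combination \<open>?u\<close> of the
  columns of \<open>B\<close> is unimodular. A maximal ideal containing \<open>g ?u\<close> must
  contain \<open>g\<close>, hence all entries outside column \<open>j\<close>; so
  \<open>g ?u\<close> and column \<open>j\<close> together are unimodular and
  \<open>unimodular_two_vectors\<close> merges them.\<close>

lemma unimodular_column_combination:
  assumes J: "finite J" "J \<noteq> {}" and I: "finite I" "I \<noteq> {}"
    and A: "\<And>i j. i \<in> I \<Longrightarrow> j \<in> J \<Longrightarrow> A i j \<in> carrier R"
    and un: "unimodular ((\<lambda>(i, j). A i j) ` (I \<times> J))"
  shows "\<exists>q\<in>J \<rightarrow> carrier R. unimodular ((\<lambda>i. \<Oplus>j\<in>J. A i j \<otimes> q j) ` I)"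
  using J A un
proof (induction J arbitrary: A rule: finite_ne_induct)
  case (singleton j)
  have "(\<lambda>i. \<Oplus>j'\<in>{j}. A i j' \<otimes> \<one>) ` I = (\<lambda>(i, j). A i j) ` (I \<times> {j})"
    using singleton.prems(1) by (force simp: image_iff)
  then show ?case using singleton.prems(2) by (intro bexI[of _ "\<lambda>_. \<one>"]) auto
next
  case (insert j J)
  have fin: "finite (I \<times> J)" "I \<times> J \<noteq> {}" using I insert.hyps by auto
  have "(\<lambda>(i, j). A i j) \<in> I \<times> J \<rightarrow> carrier R" using insert.prems by auto
  note hermite_family[OF fin this]
  then obtain g w s where [simp]: "g \<in> carrier R" and w: "w \<in> I \<times> J \<rightarrow> carrier R"
    and s: "s \<in> I \<times> J \<rightarrow> carrier R" and A': "\<forall>ij\<in>I \<times> J. (\<lambda>(i, j). A i j) ij = g \<otimes> w ij"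
    and sw: "(\<Oplus>ij\<in>I \<times> J. s ij \<otimes> w ij) = \<one>"
    by (elim bexE conjE)
  define B where "B = (\<lambda>i k. w (i, k))"
  have B [simp]: "B i k \<in> carrier R" if "i \<in> I" "k \<in> J" for i k using w that by (auto simp: B_def)
  have AB: "A i k = g \<otimes> B i k" if "i \<in> I" "k \<in> J" for i k using A' that by (auto simp: B_def)
  have "unimodular ((\<lambda>(i, j). B i j) ` (I \<times> J))" unfolding unimodular_def
  proof (intro allI impI notI)
    fix N assume N: "maximalideal N R" and sub: "(\<lambda>(i, j). B i j) ` (I \<times> J) \<subseteq> N"
    have "s ij \<otimes> w ij \<in> N" if "ij \<in> I \<times> J" for ij
      using that sub N w s by (auto simp: B_def maximalideal_mult_iff Pi_iff image_subset_iff)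
    then have "(\<Oplus>ij\<in>I \<times> J. s ij \<otimes> w ij) \<in> N" by (rule maximalideal_finsum[OF N])
    then show False using N by (simp add: sw maximalideal_one)
  qed
  then obtain q where q: "q \<in> J \<rightarrow> carrier R" and unq: "unimodular ((\<lambda>i. \<Oplus>k\<in>J. B i k \<otimes> q k) ` I)"
    using insert.IH[of B] B by auto
  have q' [simp]: "q k \<in> carrier R" if "k \<in> J" for k using q that by auto
  have Aj: "A i j \<in> carrier R" if "i \<in> I" for i using insert.prems that by simp
  let ?u = "\<lambda>i. \<Oplus>k\<in>J. B i k \<otimes> q k"
  have u: "?u i \<in> carrier R" if "i \<in> I" for i using that by (intro finsum_closed) auto
  have "unimodular ((\<lambda>i. g \<otimes> ?u i) ` I \<union> (\<lambda>i. A i j) ` I)" unfolding unimodular_def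
  proof (intro allI impI notI)
    fix N assume N: "maximalideal N R" and sub: "(\<lambda>i. g \<otimes> ?u i) ` I \<union> (\<lambda>i. A i j) ` I \<subseteq> N"
    obtain i where i: "i \<in> I" "?u i \<notin> N" using unq N by (auto simp: unimodular_def)
    then have "g \<in> N" using sub maximalideal_mult_iff[OF N, of g "?u i"] u by auto
    then have "A i k \<in> N" if "i \<in> I" "k \<in> insert j J" for i k
      using that sub AB[of i k] maximalideal_mult_iff[OF N, of g "B i k"] by auto
    then show False using insert.prems(2) N by (fastforce simp: unimodular_def)
  qed
  then obtain a b where ab [simp]: "a \<in> carrier R" "b \<in> carrier R"
    and unab: "unimodular ((\<lambda>i. a \<otimes> (g \<otimes> ?u i) \<oplus> b \<otimes> A i j) ` I)"
    using unimodular_two_vectors[OF I, of "\<lambda>i. g \<otimes> ?u i" "\<lambda>i. A i j"] u Aj by (auto simp: Pi_iff)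
  let ?q = "\<lambda>k. if k = j then b else a \<otimes> q k"
  have "(\<Oplus>k\<in>insert j J. A i k \<otimes> ?q k) = a \<otimes> (g \<otimes> ?u i) \<oplus> b \<otimes> A i j" if i: "i \<in> I" for i
  proof -
    have "(\<Oplus>k\<in>insert j J. A i k \<otimes> ?q k) = A i j \<otimes> b \<oplus> (\<Oplus>k\<in>J. A i k \<otimes> ?q k)"
      using insert.hyps insert.prems(1)[OF i] by (subst finsum_insert) auto
    also have "(\<Oplus>k\<in>J. A i k \<otimes> ?q k) = (\<Oplus>k\<in>J. (a \<otimes> g) \<otimes> (B i k \<otimes> q k))"
      using insert.hyps i by (intro finsum_cong') (auto simp: AB m_ac)
    also have "\<dots> = (a \<otimes> g) \<otimes> ?u i"
      by (rule finsum_rdistr[symmetric]) (use insert.hyps i in auto)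
    finally show ?thesis using Aj[OF i] u[OF i] by (simp add: m_ac a_comm)
  qed
  then have "(\<lambda>i. \<Oplus>k\<in>insert j J. A i k \<otimes> ?q k) ` I = (\<lambda>i. a \<otimes> (g \<otimes> ?u i) \<oplus> b \<otimes> A i j) ` I"
    by (intro image_cong) auto
  then have "unimodular ((\<lambda>i. \<Oplus>k\<in>insert j J. A i k \<otimes> ?q k) ` I)" using unab by simp
  then show ?case by (rule bexI[where x = ?q]) (use q in auto)
qed

end

section \<open>Equivalence of matrices\<close>

lemma mats_entry: "\<lbrakk>A \<in> mats R m n; i < m; j < n\<rbrakk> \<Longrightarrow> A $$ (i, j) \<in> carrier R"
  by (simp add: mats_def)

lemma mats_dim: "A \<in> mats R m n \<Longrightarrow> dim_row A = m" "A \<in> mats R m n \<Longrightarrow> dim_col A = n"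
  by (auto simp: mats_def)

lemma mat_in_mats:
  "(\<And>i j. i < m \<Longrightarrow> j < n \<Longrightarrow> f (i, j) \<in> carrier R) \<Longrightarrow> mat m n f \<in> mats R m n"
  by (simp add: mats_def)

lemma mats_eqI:
  assumes "A \<in> mats R m n" "B \<in> mats R m n"
    and "\<And>i j. i < m \<Longrightarrow> j < n \<Longrightarrow> A $$ (i, j) = B $$ (i, j)"
  shows "A = B"
  using assms by (intro eq_matI) (auto simp: mats_dim)

lemma mmult_entry:
  "\<lbrakk>A \<in> mats R m k; B \<in> mats R k n; i < m; j < n\<rbrakk>
    \<Longrightarrow> mmult R A B $$ (i, j) = (\<Oplus>\<^bsub>R\<^esub>l\<in>{..<k}. A $$ (i, l) \<otimes>\<^bsub>R\<^esub> B $$ (l, j))"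
  by (simp add: mmult_def mats_dim)

section \<open>Matrix algebra and equivalence\<close>

context cring
begin

lemma finsum_swap:
  assumes "finite A" "finite B" "\<And>i j. i \<in> A \<Longrightarrow> j \<in> B \<Longrightarrow> f i j \<in> carrier R"
  shows "(\<Oplus>i\<in>A. \<Oplus>j\<in>B. f i j) = (\<Oplus>j\<in>B. \<Oplus>i\<in>A. f i j)"
  using assms(1,3)
proof (induction A rule: finite_induct)
  case (insert i A)
  then have IH: "(\<Oplus>i\<in>A. \<Oplus>j\<in>B. f i j) = (\<Oplus>j\<in>B. \<Oplus>i\<in>A. f i j)" by simp
  have "(\<Oplus>i\<in>insert i A. \<Oplus>j\<in>B. f i j) = (\<Oplus>j\<in>B. f i j) \<oplus> (\<Oplus>i\<in>A. \<Oplus>j\<in>B. f i j)"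
    using insert by (intro finsum_insert) (auto intro!: finsum_closed)
  also have "\<dots> = (\<Oplus>j\<in>B. f i j \<oplus> (\<Oplus>i\<in>A. f i j))"
    unfolding IH using insert by (intro finsum_addf[symmetric]) (auto intro!: finsum_closed)
  also have "\<dots> = (\<Oplus>j\<in>B. \<Oplus>i\<in>insert i A. f i j)"
    using insert by (intro finsum_cong') (auto intro!: finsum_closed simp: finsum_insert Pi_def)
  finally show ?case .
qed simp

lemma finsum_restrict_support:
  assumes "finite A" "B \<subseteq> A" "\<And>i. i \<in> A \<Longrightarrow> f i \<in> carrier R" "\<And>i. i \<in> A - B \<Longrightarrow> f i = \<zero>"
  shows "finsum R f A = finsum R f B"
  by (rule add.finprod_mono_neutral_cong_right) (use assms in auto)

lemma finsum_support_single:
  assumes "finite A" "i \<in> A" "f i \<in> carrier R" "\<And>j. j \<in> A \<Longrightarrow> j \<noteq> i \<Longrightarrow> f j = \<zero>"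
  shows "finsum R f A = f i"
proof -
  have "f j \<in> carrier R" if "j \<in> A" for j using assms that by (cases "j = i") auto
  then have "finsum R f A = finsum R f {i}"
    using assms by (intro finsum_restrict_support) auto
  then show ?thesis using assms by simp
qed

lemma finsum_support_two:
  assumes "finite A" "i \<in> A" "j \<in> A" "i \<noteq> j" "f i \<in> carrier R" "f j \<in> carrier R"
    and "\<And>l. l \<in> A \<Longrightarrow> l \<noteq> i \<Longrightarrow> l \<noteq> j \<Longrightarrow> f l = \<zero>"
  shows "finsum R f A = f i \<oplus> f j"
proof -
  have "f l \<in> carrier R" if "l \<in> A" for l using assms that by (cases "l = i \<or> l = j") auto
  then have "finsum R f A = finsum R f {i, j}"
    using assms by (intro finsum_restrict_support) auto
  then show ?thesis using assms by (simp add: Pi_def)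
qed

lemma finsum_lessThan_Suc_shift:
  assumes "\<And>i. i < Suc n \<Longrightarrow> f i \<in> carrier R"
  shows "finsum R f {..<Suc n} = f 0 \<oplus> (\<Oplus>i\<in>{..<n}. f (Suc i))"
proof -
  have "finsum R f {..<Suc n} = f 0 \<oplus> finsum R f (Suc ` {..<n})"
    unfolding lessThan_Suc_eq_insert_0 using assms by (intro finsum_insert) auto
  also have "finsum R f (Suc ` {..<n}) = (\<Oplus>i\<in>{..<n}. f (Suc i))"
    using assms by (intro finsum_reindex) auto
  finally show ?thesis .
qed

lemma mmult_in_mats:
  assumes "A \<in> mats R m k" "B \<in> mats R k n"
  shows "mmult R A B \<in> mats R m n"
  unfolding mmult_def mats_dim[OF assms(1)] mats_dim[OF assms(2)]
  by (rule mat_in_mats) (use assms in \<open>auto intro!: finsum_closed simp: mats_entry\<close>)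

lemma mone_in_mats: "mone R n \<in> mats R n n"
  unfolding mone_def by (rule mat_in_mats) auto

lemma mmult_assoc:
  assumes A: "A \<in> mats R m k" and B: "B \<in> mats R k l" and C: "C \<in> mats R l n"
  shows "mmult R (mmult R A B) C = mmult R A (mmult R B C)"
proof (rule mats_eqI)
  show "mmult R (mmult R A B) C \<in> mats R m n" "mmult R A (mmult R B C) \<in> mats R m n"
    using assms by (auto intro: mmult_in_mats)
  fix i j assume i: "i < m" and j: "j < n"
  note [simp] = mats_entry[OF A i] mats_entry[OF B] mats_entry[OF C _ j]
  have "mmult R (mmult R A B) C $$ (i, j)
      = (\<Oplus>q\<in>{..<l}. (\<Oplus>p\<in>{..<k}. A $$ (i, p) \<otimes> B $$ (p, q)) \<otimes> C $$ (q, j))"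
    unfolding mmult_entry[OF mmult_in_mats[OF A B] C i j]
    using i by (intro finsum_cong') (auto simp: mmult_entry[OF A B])
  also have "\<dots> = (\<Oplus>q\<in>{..<l}. \<Oplus>p\<in>{..<k}. A $$ (i, p) \<otimes> B $$ (p, q) \<otimes> C $$ (q, j))"
    by (intro finsum_cong' finsum_ldistr) auto
  also have "\<dots> = (\<Oplus>p\<in>{..<k}. \<Oplus>q\<in>{..<l}. A $$ (i, p) \<otimes> B $$ (p, q) \<otimes> C $$ (q, j))"
    by (rule finsum_swap) auto
  also have "\<dots> = (\<Oplus>p\<in>{..<k}. A $$ (i, p) \<otimes> (\<Oplus>q\<in>{..<l}. B $$ (p, q) \<otimes> C $$ (q, j)))"
    by (intro finsum_cong') (auto simp: finsum_rdistr m_assoc intro!: finsum_cong')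
  also have "\<dots> = mmult R A (mmult R B C) $$ (i, j)"
    unfolding mmult_entry[OF A mmult_in_mats[OF B C] i j]
    using j by (intro finsum_cong') (auto simp: mmult_entry[OF B C])
  finally show "mmult R (mmult R A B) C $$ (i, j) = mmult R A (mmult R B C) $$ (i, j)" .
qed

lemma mone_entry: "\<lbrakk>i < n; j < n\<rbrakk> \<Longrightarrow> mone R n $$ (i, j) = (if i = j then \<one> else \<zero>)"
  by (simp add: mone_def)

lemma mmult_mone_left:
  assumes A: "A \<in> mats R m n"
  shows "mmult R (mone R m) A = A"
proof (rule mats_eqI[OF mmult_in_mats[OF mone_in_mats A] A])
  fix i j assume i: "i < m" and j: "j < n"
  have "mmult R (mone R m) A $$ (i, j) = (\<Oplus>l\<in>{..<m}. mone R m $$ (i, l) \<otimes> A $$ (l, j))"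
    by (rule mmult_entry[OF mone_in_mats A i j])
  also have "\<dots> = mone R m $$ (i, i) \<otimes> A $$ (i, j)"
    by (rule finsum_support_single) (use i j in \<open>auto simp: mone_entry mats_entry[OF A]\<close>)
  finally show "mmult R (mone R m) A $$ (i, j) = A $$ (i, j)"
    using i j by (simp add: mone_entry mats_entry[OF A])
qed

lemma mmult_mone_right:
  assumes A: "A \<in> mats R m n"
  shows "mmult R A (mone R n) = A"
proof (rule mats_eqI[OF mmult_in_mats[OF A mone_in_mats] A])
  fix i j assume i: "i < m" and j: "j < n"
  have "mmult R A (mone R n) $$ (i, j) = (\<Oplus>l\<in>{..<n}. A $$ (i, l) \<otimes> mone R n $$ (l, j))"
    by (rule mmult_entry[OF A mone_in_mats i j])
  also have "\<dots> = A $$ (i, j) \<otimes> mone R n $$ (j, j)"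
    by (rule finsum_support_single) (use i j in \<open>auto simp: mone_entry mats_entry[OF A]\<close>)
  finally show "mmult R A (mone R n) $$ (i, j) = A $$ (i, j)"
    using i j by (simp add: mone_entry mats_entry[OF A])
qed

lemma invertible_in_mats: "P \<in> invertible_mats R n \<Longrightarrow> P \<in> mats R n n"
  by (simp add: invertible_mats_def)

lemma invertible_matsI:
  "\<lbrakk>P \<in> mats R n n; P' \<in> mats R n n; mmult R P P' = mone R n; mmult R P' P = mone R n\<rbrakk>
    \<Longrightarrow> P \<in> invertible_mats R n"
  by (auto simp: invertible_mats_def)

lemma invertible_matsE:
  assumes "P \<in> invertible_mats R n"
  obtains P' where "P' \<in> invertible_mats R n" "mmult R P P' = mone R n" "mmult R P' P = mone R n"
  using assms by (auto simp: invertible_mats_def)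

lemma invertible_mone: "mone R n \<in> invertible_mats R n"
  by (rule invertible_matsI[OF mone_in_mats mone_in_mats])
    (simp_all add: mmult_mone_left[OF mone_in_mats])

lemma invertible_mmult:
  assumes "P \<in> invertible_mats R n" "Q \<in> invertible_mats R n"
  shows "mmult R P Q \<in> invertible_mats R n"
proof -
  obtain P' where P': "P' \<in> invertible_mats R n" "mmult R P P' = mone R n" "mmult R P' P = mone R n"
    using assms(1) by (rule invertible_matsE)
  obtain Q' where Q': "Q' \<in> invertible_mats R n" "mmult R Q Q' = mone R n" "mmult R Q' Q = mone R n"
    using assms(2) by (rule invertible_matsE)
  note m = invertible_in_mats[OF assms(1)] invertible_in_mats[OF assms(2)]
    invertible_in_mats[OF P'(1)] invertible_in_mats[OF Q'(1)]
  have cancel: "mmult R (mmult R A B) (mmult R B' A') = mone R n"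
    if c: "A \<in> mats R n n" "B \<in> mats R n n" "B' \<in> mats R n n" "A' \<in> mats R n n"
      and i: "mmult R A A' = mone R n" "mmult R B B' = mone R n" for A B A' B'
  proof -
    have "mmult R (mmult R A B) (mmult R B' A') = mmult R A (mmult R (mmult R B B') A')"
      using c by (simp add: mmult_assoc[of _ n n _ n _ n] mmult_in_mats[of _ n n _ n])
    then show ?thesis using c i by (simp add: mmult_mone_left[of _ n n])
  qed
  show ?thesis
    by (rule invertible_matsI[OF mmult_in_mats[OF m(1,2)] mmult_in_mats[OF m(4,3)]])
      (rule cancel; use m P' Q' in simp)+
qed

definition mat_equiv :: "nat \<Rightarrow> nat \<Rightarrow> 'a mat \<Rightarrow> 'a mat \<Rightarrow> bool" where
  "mat_equiv m n A B \<longleftrightarrow> A \<in> mats R m n \<and>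
     (\<exists>P\<in>invertible_mats R m. \<exists>Q\<in>invertible_mats R n. B = mmult R (mmult R P A) Q)"

lemma mat_equivI:
  "\<lbrakk>A \<in> mats R m n; P \<in> invertible_mats R m; Q \<in> invertible_mats R n;
    B = mmult R (mmult R P A) Q\<rbrakk> \<Longrightarrow> mat_equiv m n A B"
  by (auto simp: mat_equiv_def)

lemma mat_equiv_refl: "A \<in> mats R m n \<Longrightarrow> mat_equiv m n A A"
  by (rule mat_equivI[OF _ invertible_mone invertible_mone])
    (simp_all add: mmult_mone_left mmult_mone_right)

lemma mat_equiv_trans:
  assumes "mat_equiv m n A B" "mat_equiv m n B C"
  shows "mat_equiv m n A C"
proof -
  obtain P Q where A: "A \<in> mats R m n" and PQ: "P \<in> invertible_mats R m" "Q \<in> invertible_mats R n"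
    and B: "B = mmult R (mmult R P A) Q" using assms(1) by (auto simp: mat_equiv_def)
  obtain P' Q' where PQ': "P' \<in> invertible_mats R m" "Q' \<in> invertible_mats R n"
    and C: "C = mmult R (mmult R P' B) Q'" using assms(2) by (auto simp: mat_equiv_def)
  note m = A PQ[THEN invertible_in_mats] PQ'[THEN invertible_in_mats]
  have PA: "mmult R P A \<in> mats R m n" using m by (intro mmult_in_mats)
  have "C = mmult R (mmult R (mmult R P' (mmult R P A)) Q) Q'"
    unfolding B C by (simp only: mmult_assoc[OF m(4) PA m(3)])
  also have "mmult R P' (mmult R P A) = mmult R (mmult R P' P) A"
    by (simp only: mmult_assoc[OF m(4) m(2) m(1)])
  also have "mmult R (mmult R (mmult R (mmult R P' P) A) Q) Q'
      = mmult R (mmult R (mmult R P' P) A) (mmult R Q Q')"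
    by (rule mmult_assoc[OF mmult_in_mats[OF mmult_in_mats[OF m(4,2)] m(1)] m(3,5)])
  finally show ?thesis
    by (intro mat_equivI[OF A invertible_mmult[OF PQ'(1) PQ(1)] invertible_mmult[OF PQ(2) PQ'(2)]])
qed

definition scale_mat :: "'a \<Rightarrow> 'a mat \<Rightarrow> 'a mat" where
  "scale_mat g A = map_mat (\<lambda>x. g \<otimes> x) A"

lemma scale_mat_in_mats: "\<lbrakk>g \<in> carrier R; A \<in> mats R m n\<rbrakk> \<Longrightarrow> scale_mat g A \<in> mats R m n"
  by (auto simp: scale_mat_def mats_def)

lemma scale_mat_entry:
  "\<lbrakk>A \<in> mats R m n; i < m; j < n\<rbrakk> \<Longrightarrow> scale_mat g A $$ (i, j) = g \<otimes> A $$ (i, j)"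
  by (simp add: scale_mat_def mats_dim)

lemma mmult_scale_right:
  assumes g: "g \<in> carrier R" and A: "A \<in> mats R m k" and B: "B \<in> mats R k n"
  shows "mmult R A (scale_mat g B) = scale_mat g (mmult R A B)"
proof (rule mats_eqI[of _ R m n])
  fix i j assume i: "i < m" and j: "j < n"
  have "(\<Oplus>l\<in>{..<k}. A $$ (i, l) \<otimes> scale_mat g B $$ (l, j))
      = (\<Oplus>l\<in>{..<k}. g \<otimes> (A $$ (i, l) \<otimes> B $$ (l, j)))"
    using i j g by (intro finsum_cong') (auto simp: scale_mat_entry[OF B] mats_entry[OF A] mats_entry[OF B] m_ac)
  also have "\<dots> = g \<otimes> (\<Oplus>l\<in>{..<k}. A $$ (i, l) \<otimes> B $$ (l, j))"
    using i j g by (intro finsum_rdistr[symmetric]) (auto simp: mats_entry[OF A] mats_entry[OF B])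
  finally show "mmult R A (scale_mat g B) $$ (i, j) = scale_mat g (mmult R A B) $$ (i, j)"
    using i j g by (simp add: mmult_entry[OF A scale_mat_in_mats[OF g B]] mmult_entry[OF A B]
        scale_mat_entry[OF mmult_in_mats[OF A B]])
qed (use assms in \<open>auto intro: mmult_in_mats scale_mat_in_mats\<close>)

lemma mmult_scale_left:
  assumes g: "g \<in> carrier R" and A: "A \<in> mats R m k" and B: "B \<in> mats R k n"
  shows "mmult R (scale_mat g A) B = scale_mat g (mmult R A B)"
proof (rule mats_eqI[of _ R m n])
  fix i j assume i: "i < m" and j: "j < n"
  have "(\<Oplus>l\<in>{..<k}. scale_mat g A $$ (i, l) \<otimes> B $$ (l, j))
      = (\<Oplus>l\<in>{..<k}. g \<otimes> (A $$ (i, l) \<otimes> B $$ (l, j)))"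
    using i j g by (intro finsum_cong') (auto simp: scale_mat_entry[OF A] mats_entry[OF A] mats_entry[OF B] m_ac)
  also have "\<dots> = g \<otimes> (\<Oplus>l\<in>{..<k}. A $$ (i, l) \<otimes> B $$ (l, j))"
    using i j g by (intro finsum_rdistr[symmetric]) (auto simp: mats_entry[OF A] mats_entry[OF B])
  finally show "mmult R (scale_mat g A) B $$ (i, j) = scale_mat g (mmult R A B) $$ (i, j)"
    using i j g by (simp add: mmult_entry[OF scale_mat_in_mats[OF g A] B] mmult_entry[OF A B]
        scale_mat_entry[OF mmult_in_mats[OF A B]])
qed (use assms in \<open>auto intro: mmult_in_mats scale_mat_in_mats\<close>)

text \<open>Allows the gcd of the entries to be split off before a reduction and put back
  afterwards.\<close>

lemma mat_equiv_scale:
  assumes g: "g \<in> carrier R" and "mat_equiv m n A B"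
  shows "mat_equiv m n (scale_mat g A) (scale_mat g B)"
proof -
  obtain P Q where A: "A \<in> mats R m n" and PQ: "P \<in> invertible_mats R m" "Q \<in> invertible_mats R n"
    and B: "B = mmult R (mmult R P A) Q" using assms(2) by (auto simp: mat_equiv_def)
  note m = PQ[THEN invertible_in_mats]
  show ?thesis
    by (rule mat_equivI[OF scale_mat_in_mats[OF g A] PQ])
      (simp only: B mmult_scale_right[OF g m(1) A] mmult_scale_left[OF g mmult_in_mats[OF m(1) A] m(2)])
qed

definition unit_block :: "nat \<Rightarrow> nat \<Rightarrow> 'a mat \<Rightarrow> 'a mat" where
  "unit_block m n B = mat (Suc m) (Suc n) (\<lambda>(i, j). case (i, j) of
     (0, 0) \<Rightarrow> \<one> | (Suc i, Suc j) \<Rightarrow> B $$ (i, j) | _ \<Rightarrow> \<zero>)"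

lemma unit_block_entry [simp]:
  "unit_block m n B $$ (0, 0) = \<one>"
  "j < n \<Longrightarrow> unit_block m n B $$ (0, Suc j) = \<zero>"
  "i < m \<Longrightarrow> unit_block m n B $$ (Suc i, 0) = \<zero>"
  "\<lbrakk>i < m; j < n\<rbrakk> \<Longrightarrow> unit_block m n B $$ (Suc i, Suc j) = B $$ (i, j)"
  by (simp_all add: unit_block_def)

lemma unit_block_in_mats: "B \<in> mats R m n \<Longrightarrow> unit_block m n B \<in> mats R (Suc m) (Suc n)"
  unfolding unit_block_def by (rule mat_in_mats) (auto simp: mats_entry split: nat.split)

lemma unit_block_mone: "unit_block n n (mone R n) = mone R (Suc n)"
proof (rule mats_eqI[OF unit_block_in_mats[OF mone_in_mats] mone_in_mats])
  fix i j assume "i < Suc n" "j < Suc n"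
  then show "unit_block n n (mone R n) $$ (i, j) = mone R (Suc n) $$ (i, j)"
    by (cases i; cases j) (auto simp: mone_entry)
qed

lemma unit_block_mmult:
  assumes A: "A \<in> mats R m k" and B: "B \<in> mats R k n"
  shows "mmult R (unit_block m k A) (unit_block k n B) = unit_block m n (mmult R A B)"
proof (rule mats_eqI[OF mmult_in_mats[OF unit_block_in_mats[OF A] unit_block_in_mats[OF B]]
      unit_block_in_mats[OF mmult_in_mats[OF A B]]])
  fix i j assume i: "i < Suc m" and j: "j < Suc n"
  note [simp] = mats_entry[OF A] mats_entry[OF B]
    mats_entry[OF unit_block_in_mats[OF A]] mats_entry[OF unit_block_in_mats[OF B]]
  have "mmult R (unit_block m k A) (unit_block k n B) $$ (i, j)
      = unit_block m k A $$ (i, 0) \<otimes> unit_block k n B $$ (0, j)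
        \<oplus> (\<Oplus>l\<in>{..<k}. unit_block m k A $$ (i, Suc l) \<otimes> unit_block k n B $$ (Suc l, j))"
    unfolding mmult_entry[OF unit_block_in_mats[OF A] unit_block_in_mats[OF B] i j]
    by (rule finsum_lessThan_Suc_shift) (use i j in auto)
  also have "\<dots> = unit_block m n (mmult R A B) $$ (i, j)"
  proof (cases i)
    case 0
    have "(\<Oplus>l\<in>{..<k}. unit_block m k A $$ (i, Suc l) \<otimes> unit_block k n B $$ (Suc l, j)) = \<zero>"
      by (rule add.finprod_one_eqI) (use 0 j in auto)
    then show ?thesis using 0 j by (cases j) auto
  next
    case (Suc i')
    show ?thesis
    proof (cases j)
      case 0
      have "(\<Oplus>l\<in>{..<k}. unit_block m k A $$ (i, Suc l) \<otimes> unit_block k n B $$ (Suc l, j)) = \<zero>"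
        by (rule add.finprod_one_eqI) (use 0 Suc i in auto)
      then show ?thesis using 0 Suc i by auto
    next
      case (Suc j')
      have "(\<Oplus>l\<in>{..<k}. unit_block m k A $$ (i, Suc l) \<otimes> unit_block k n B $$ (Suc l, j))
          = (\<Oplus>l\<in>{..<k}. A $$ (i', l) \<otimes> B $$ (l, j'))"
        by (rule finsum_cong') (use \<open>i = Suc i'\<close> Suc i j in auto)
      then show ?thesis using \<open>i = Suc i'\<close> Suc i j
        by (auto simp: mmult_entry[OF A B] intro!: finsum_closed)
    qed
  qed
  finally show "mmult R (unit_block m k A) (unit_block k n B) $$ (i, j)
    = unit_block m n (mmult R A B) $$ (i, j)" .
qed

lemma invertible_unit_block:
  assumes "P \<in> invertible_mats R n"
  shows "unit_block n n P \<in> invertible_mats R (Suc n)"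
proof -
  obtain P' where P': "P' \<in> invertible_mats R n" "mmult R P P' = mone R n" "mmult R P' P = mone R n"
    using assms by (rule invertible_matsE)
  note m = assms[THEN invertible_in_mats] P'(1)[THEN invertible_in_mats]
  show ?thesis
    by (rule invertible_matsI[OF unit_block_in_mats[OF m(1)] unit_block_in_mats[OF m(2)]])
      (simp_all add: unit_block_mmult[OF m(1,2)] unit_block_mmult[OF m(2,1)] P' unit_block_mone)
qed

lemma mat_equiv_unit_block:
  assumes "mat_equiv m n A B"
  shows "mat_equiv (Suc m) (Suc n) (unit_block m n A) (unit_block m n B)"
proof -
  obtain P Q where A: "A \<in> mats R m n" and PQ: "P \<in> invertible_mats R m" "Q \<in> invertible_mats R n"
    and B: "B = mmult R (mmult R P A) Q" using assms by (auto simp: mat_equiv_def)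
  note m = PQ[THEN invertible_in_mats]
  show ?thesis
    by (rule mat_equivI[OF unit_block_in_mats[OF A] PQ[THEN invertible_unit_block]])
      (simp only: B unit_block_mmult[OF m(1) A] unit_block_mmult[OF mmult_in_mats[OF m(1) A] m(2)])
qed

text \<open>The two by two matrix with rows \<open>(a, b)\<close> and \<open>(c, d)\<close> acting
  on coordinates 0 and \<open>k\<close>, the identity on all others: the shape of a single gcd
  step.\<close>

definition pair_mat :: "nat \<Rightarrow> nat \<Rightarrow> 'a \<Rightarrow> 'a \<Rightarrow> 'a \<Rightarrow> 'a \<Rightarrow> 'a mat" where
  "pair_mat m k a b c d = mat m m (\<lambda>(i, j).
     if i = 0 then (if j = 0 then a else if j = k then b else \<zero>)
     else if i = k then (if j = 0 then c else if j = k then d else \<zero>)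
     else if i = j then \<one> else \<zero>)"

lemma pair_mat_in_mats:
  "{a, b, c, d} \<subseteq> carrier R \<Longrightarrow> pair_mat m k a b c d \<in> mats R m m"
  unfolding pair_mat_def by (rule mat_in_mats) auto

lemma mmult_pair_mat_entry:
  assumes carr [simp]: "a \<in> carrier R" "b \<in> carrier R" "c \<in> carrier R" "d \<in> carrier R"
    and k: "0 < k" "k < m" and B: "B \<in> mats R m n" and i: "i < m" and j: "j < n"
  shows "mmult R (pair_mat m k a b c d) B $$ (i, j)
    = (if i = 0 then a \<otimes> B $$ (0, j) \<oplus> b \<otimes> B $$ (k, j)
       else if i = k then c \<otimes> B $$ (0, j) \<oplus> d \<otimes> B $$ (k, j) else B $$ (i, j))"
proof -
  let ?E = "pair_mat m k a b c d"
  have E: "?E \<in> mats R m m" by (rule pair_mat_in_mats) simp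
  note [simp] = mats_entry[OF B _ j]
  have eq: "mmult R ?E B $$ (i, j) = (\<Oplus>l\<in>{..<m}. ?E $$ (i, l) \<otimes> B $$ (l, j))"
    by (rule mmult_entry[OF E B i j])
  show ?thesis
  proof (cases "i = 0 \<or> i = k")
    case True
    have "(\<Oplus>l\<in>{..<m}. ?E $$ (i, l) \<otimes> B $$ (l, j))
        = ?E $$ (i, 0) \<otimes> B $$ (0, j) \<oplus> ?E $$ (i, k) \<otimes> B $$ (k, j)"
      by (rule finsum_support_two) (use True k in \<open>auto simp: pair_mat_def\<close>)
    then show ?thesis using True k unfolding eq by (auto simp: pair_mat_def)
  next
    case False
    have "(\<Oplus>l\<in>{..<m}. ?E $$ (i, l) \<otimes> B $$ (l, j)) = ?E $$ (i, i) \<otimes> B $$ (i, j)"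
      by (rule finsum_support_single) (use False i in \<open>auto simp: pair_mat_def\<close>)
    then show ?thesis using False i unfolding eq by (auto simp: pair_mat_def)
  qed
qed

lemma pair_mat_mmult_mone:
  assumes carr [simp]: "a \<in> carrier R" "b \<in> carrier R" "c \<in> carrier R" "d \<in> carrier R"
    "a' \<in> carrier R" "b' \<in> carrier R" "c' \<in> carrier R" "d' \<in> carrier R"
    and k: "0 < k" "k < m"
    and inv: "a \<otimes> a' \<oplus> b \<otimes> c' = \<one>" "a \<otimes> b' \<oplus> b \<otimes> d' = \<zero>"
      "c \<otimes> a' \<oplus> d \<otimes> c' = \<zero>" "c \<otimes> b' \<oplus> d \<otimes> d' = \<one>"
  shows "mmult R (pair_mat m k a b c d) (pair_mat m k a' b' c' d') = mone R m"
proof -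
  have E: "pair_mat m k a b c d \<in> mats R m m" "pair_mat m k a' b' c' d' \<in> mats R m m"
    by (rule pair_mat_in_mats, simp)+
  show ?thesis
  proof (rule mats_eqI[OF mmult_in_mats[OF E] mone_in_mats])
    fix i j assume ij: "i < m" "j < m"
    show "mmult R (pair_mat m k a b c d) (pair_mat m k a' b' c' d') $$ (i, j) = mone R m $$ (i, j)"
      unfolding mmult_pair_mat_entry[OF carr(1-4) k E(2) ij]
      using k ij inv by (auto simp: pair_mat_def mone_def)
  qed
qed

definition first_row_mat :: "nat \<Rightarrow> (nat \<Rightarrow> 'a) \<Rightarrow> 'a mat" where
  "first_row_mat n r = mat n n (\<lambda>(i, j). if i = 0 then r j else if i = j then \<one> else \<zero>)"

lemma first_row_mat_in_mats:
  "(\<And>j. j < n \<Longrightarrow> r j \<in> carrier R) \<Longrightarrow> first_row_mat n r \<in> mats R n n"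
  unfolding first_row_mat_def by (rule mat_in_mats) auto

lemma first_row_mat_mmult_mone:
  assumes r: "\<And>j. j < n \<Longrightarrow> r j \<in> carrier R" and w [simp]: "w \<in> carrier R" and rw: "r 0 \<otimes> w = \<one>"
  defines "r' \<equiv> \<lambda>j. if j = 0 then w else \<ominus> (w \<otimes> r j)"
  shows "mmult R (first_row_mat n r) (first_row_mat n r') = mone R n"
    "mmult R (first_row_mat n r') (first_row_mat n r) = mone R n"
proof -
  \<comment> \<open>Off the diagonal only the equation \<open>p 0 q j + p j = 0\<close> has to be
    checked. It holds for \<open>(r, r')\<close> and for \<open>(r', r)\<close>, so both products
    are instances.\<close>
  have main: "mmult R (first_row_mat n p) (first_row_mat n q) = mone R n"
    if p: "\<And>j. j < n \<Longrightarrow> p j \<in> carrier R" and q: "\<And>j. j < n \<Longrightarrow> q j \<in> carrier R"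
      and 0: "0 < n \<Longrightarrow> p 0 \<otimes> q 0 = \<one>" and pq: "\<And>j. j < n \<Longrightarrow> 0 < j \<Longrightarrow> p 0 \<otimes> q j \<oplus> p j = \<zero>" for p q
  proof -
    note P = first_row_mat_in_mats[of n p, OF p] and Q = first_row_mat_in_mats[of n q, OF q]
    let ?P = "first_row_mat n p" and ?Q = "first_row_mat n q"
    show ?thesis
    proof (rule mats_eqI[OF mmult_in_mats[OF P Q] mone_in_mats])
      fix i j assume i: "i < n" and j: "j < n"
      have eq: "mmult R ?P ?Q $$ (i, j) = (\<Oplus>l\<in>{..<n}. ?P $$ (i, l) \<otimes> ?Q $$ (l, j))"
        by (rule mmult_entry[OF P Q i j])
      show "mmult R ?P ?Q $$ (i, j) = mone R n $$ (i, j)"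
      proof (cases "i = 0")
        case False
        have "(\<Oplus>l\<in>{..<n}. ?P $$ (i, l) \<otimes> ?Q $$ (l, j)) = ?P $$ (i, i) \<otimes> ?Q $$ (i, j)"
          by (rule finsum_support_single) (use False i j q in \<open>auto simp: first_row_mat_def\<close>)
        then show ?thesis using False i j unfolding eq by (auto simp: first_row_mat_def mone_def)
      next
        case i0: True
        show ?thesis
        proof (cases "j = 0")
          case True
          have "(\<Oplus>l\<in>{..<n}. ?P $$ (i, l) \<otimes> ?Q $$ (l, j)) = ?P $$ (i, 0) \<otimes> ?Q $$ (0, j)"
            by (rule finsum_support_single) (use True i0 i j p q in \<open>auto simp: first_row_mat_def\<close>)
          then show ?thesis using True i0 i j 0 unfolding eq by (auto simp: first_row_mat_def mone_def)
        next
          case False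
          have "(\<Oplus>l\<in>{..<n}. ?P $$ (i, l) \<otimes> ?Q $$ (l, j))
              = ?P $$ (i, 0) \<otimes> ?Q $$ (0, j) \<oplus> ?P $$ (i, j) \<otimes> ?Q $$ (j, j)"
            by (rule finsum_support_two) (use False i0 i j p q in \<open>auto simp: first_row_mat_def\<close>)
          then show ?thesis using False i0 i j pq p unfolding eq
            by (auto simp: first_row_mat_def mone_def)
        qed
      qed
    qed
  qed
  have r': "r' j \<in> carrier R" if "j < n" for j using r that by (simp add: r'_def)
  have 1: "r 0 \<otimes> r' j \<oplus> r j = \<zero>" if "j < n" "0 < j" for j
  proof -
    have c: "r 0 \<in> carrier R" "r j \<in> carrier R" using r that by auto
    have "r 0 \<otimes> r' j \<oplus> r j = \<ominus> ((r 0 \<otimes> w) \<otimes> r j) \<oplus> r j"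
      using c that by (simp add: r'_def m_assoc r_minus)
    then show ?thesis using c by (simp add: rw l_neg)
  qed
  have 2: "r' 0 \<otimes> r j \<oplus> r' j = \<zero>" if "j < n" "0 < j" for j
    using r that by (simp add: r'_def r_neg)
  show "mmult R (first_row_mat n r) (first_row_mat n r') = mone R n"
    by (rule main) (use r r' 1 rw in \<open>auto simp: r'_def\<close>)
  show "mmult R (first_row_mat n r') (first_row_mat n r) = mone R n"
    by (rule main) (use r r' 2 rw in \<open>auto simp: r'_def m_comm\<close>)
qed

end

section \<open>Reduction to diagonal form\<close>

context hermite_ring
begin

text \<open>Reduction of \<open>v\<close> to \<open>(g, 0, ..., 0)\<close>, with the inverse of the
  reducing matrix moved to the other side. The induction is on a bound \<open>k\<close> for the
  indices of nonzero entries; a step replaces entries 0 and \<open>k\<close> by their gcd and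
  0.\<close>

lemma vector_multiple_of_first_column:
  assumes m: "0 < m" and v: "\<And>i. i < m \<Longrightarrow> v i \<in> carrier R"
  shows "\<exists>P\<in>invertible_mats R m. \<exists>g\<in>carrier R. \<forall>i<m. v i = P $$ (i, 0) \<otimes> g"
proof -
  have "\<exists>P\<in>invertible_mats R m. \<exists>g\<in>carrier R. \<forall>i<m. v i = P $$ (i, 0) \<otimes> g"
    if "k < m" "\<And>i. i < m \<Longrightarrow> v i \<in> carrier R" "\<And>i. i < m \<Longrightarrow> k < i \<Longrightarrow> v i = \<zero>" for k v
    using that
  proof (induction k arbitrary: v)
    case 0
    have "v i = mone R m $$ (i, 0) \<otimes> v 0" if "i < m" for i
      using 0 that by (cases "i = 0") (auto simp: mone_entry)
    then show ?case using invertible_mone 0 m by blast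
  next
    case (Suc k)
    let ?k = "Suc k"
    obtain d a b s t where [simp]: "d \<in> carrier R" "a \<in> carrier R" "b \<in> carrier R" "s \<in> carrier R" "t \<in> carrier R"
      and ab: "v 0 = d \<otimes> a" "v ?k = d \<otimes> b" and st: "s \<otimes> a \<oplus> t \<otimes> b = \<one>"
      using hermite[of "v 0" "v ?k"] Suc.prems(1,2) m by auto
    let ?v = "\<lambda>i. if i = 0 then d else if i = ?k then \<zero> else v i"
    have "\<exists>P\<in>invertible_mats R m. \<exists>g\<in>carrier R. \<forall>i<m. ?v i = P $$ (i, 0) \<otimes> g"
      by (rule Suc.IH) (use Suc.prems in auto)
    then obtain P g where P: "P \<in> invertible_mats R m" and [simp]: "g \<in> carrier R"
      and vP: "\<And>i. i < m \<Longrightarrow> ?v i = P $$ (i, 0) \<otimes> g" by blast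
    \<comment> \<open>The cofactor column \<open>(a, b)\<close> is completed by
      \<open>(-t, s)\<close> to determinant 1, so \<open>?E\<close> takes \<open>(d, 0)\<close> back
      to \<open>(v 0, v ?k)\<close>.\<close>
    let ?E = "pair_mat m ?k a (\<ominus> t) b s" and ?E' = "pair_mat m ?k s t (\<ominus> b) a"
    have as: "a \<otimes> s \<oplus> b \<otimes> t = \<one>" using st by (simp add: m_comm)
    have "?E \<in> invertible_mats R m"
    proof (rule invertible_matsI)
      show "mmult R ?E ?E' = mone R m"
        by (rule pair_mat_mmult_mone) (use as st Suc.prems in \<open>simp_all add: ring_norm\<close>)
      show "mmult R ?E' ?E = mone R m"
        by (rule pair_mat_mmult_mone) (use as st Suc.prems in \<open>simp_all add: ring_norm\<close>)
    qed (simp_all add: pair_mat_in_mats)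
    then have EP: "mmult R ?E P \<in> invertible_mats R m" using P by (rule invertible_mmult)
    have Pm: "P \<in> mats R m m" using P by (rule invertible_in_mats)
    note [simp] = mats_entry[OF Pm]
    have P0: "P $$ (0, 0) \<otimes> g = d" "P $$ (?k, 0) \<otimes> g = \<zero>" using vP[of 0] vP[of ?k] m Suc.prems by auto
    have "v i = mmult R ?E P $$ (i, 0) \<otimes> g" if i: "i < m" for i
    proof -
      have lin: "(x \<otimes> P $$ (0, 0) \<oplus> y \<otimes> P $$ (?k, 0)) \<otimes> g = x \<otimes> d"
        if [simp]: "x \<in> carrier R" "y \<in> carrier R" for x y
        using P0 m Suc.prems(1) by (simp add: l_distr m_assoc)
      have "mmult R ?E P $$ (i, 0) = (if i = 0 then a \<otimes> P $$ (0, 0) \<oplus> \<ominus> t \<otimes> P $$ (?k, 0)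
          else if i = ?k then b \<otimes> P $$ (0, 0) \<oplus> s \<otimes> P $$ (?k, 0) else P $$ (i, 0))"
        by (rule mmult_pair_mat_entry[OF _ _ _ _ _ _ Pm]) (use Suc.prems i m in simp_all)
      then show ?thesis using vP[OF i] ab lin by (auto simp: m_comm)
    qed
    then show ?case using EP by (intro bexI[of _ "mmult R ?E P"] bexI[of _ g]) auto
  qed
  from this[of "m - 1" v] show ?thesis using m v by auto
qed

end

context countable_pp_hermite_ring
begin

text \<open>
  Choose \<open>q\<close> with \<open>A q\<close> unimodular. Since \<open>q\<close> is a multiple of the first column of an invertible
  \<open>Q\<close>, the first column of \<open>A Q\<close> is unimodular, hence a unit multiple of the first column of an
  invertible \<open>P\<close>. So the first column of \<open>P\<^sup>-\<^sup>1 A Q\<close> is a unit followed by zeros.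
\<close>

lemma unimodular_mat_equiv_unit_block:
  assumes A: "A \<in> mats R (Suc m) (Suc n)"
    and un: "unimodular ((\<lambda>(i, j). A $$ (i, j)) ` ({..<Suc m} \<times> {..<Suc n}))"
  shows "\<exists>B\<in>mats R m n. mat_equiv (Suc m) (Suc n) A (unit_block m n B)"
proof -
  have "\<exists>q\<in>{..<Suc n} \<rightarrow> carrier R. unimodular ((\<lambda>i. \<Oplus>j\<in>{..<Suc n}. A $$ (i, j) \<otimes> q j) ` {..<Suc m})"
    by (rule unimodular_column_combination) (use un in \<open>auto simp: mats_entry[OF A]\<close>)
  then obtain q where q: "q \<in> {..<Suc n} \<rightarrow> carrier R"
    and unq: "unimodular ((\<lambda>i. \<Oplus>j\<in>{..<Suc n}. A $$ (i, j) \<otimes> q j) ` {..<Suc m})" by (elim bexE)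
  have "\<exists>Q\<in>invertible_mats R (Suc n). \<exists>g\<in>carrier R. \<forall>j<Suc n. q j = Q $$ (j, 0) \<otimes> g"
    by (rule vector_multiple_of_first_column) (use q in auto)
  then obtain Q g where Q: "Q \<in> invertible_mats R (Suc n)" and g [simp]: "g \<in> carrier R"
    and qQ: "\<And>j. j < Suc n \<Longrightarrow> q j = Q $$ (j, 0) \<otimes> g" by blast
  note Qm = invertible_in_mats[OF Q]
  let ?B = "mmult R A Q"
  have B: "?B \<in> mats R (Suc m) (Suc n)" by (rule mmult_in_mats[OF A Qm])
  have "\<exists>P\<in>invertible_mats R (Suc m). \<exists>h\<in>carrier R. \<forall>i<Suc m. ?B $$ (i, 0) = P $$ (i, 0) \<otimes> h"
    by (rule vector_multiple_of_first_column) (simp_all add: mats_entry[OF B])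
  then obtain P h where P: "P \<in> invertible_mats R (Suc m)" and h [simp]: "h \<in> carrier R"
    and BP: "\<And>i. i < Suc m \<Longrightarrow> ?B $$ (i, 0) = P $$ (i, 0) \<otimes> h" by blast
  note Pm = invertible_in_mats[OF P]
  \<comment> \<open>Every entry of the unimodular vector \<open>A q\<close> is a multiple of
    \<open>h\<close>, so \<open>h\<close> is a unit.\<close>
  have "h \<notin> N" if N: "maximalideal N R" for N
  proof
    assume hN: "h \<in> N"
    have "(\<Oplus>j\<in>{..<Suc n}. A $$ (i, j) \<otimes> q j) \<in> N" if i: "i < Suc m" for i
    proof -
      have "(\<Oplus>j\<in>{..<Suc n}. A $$ (i, j) \<otimes> q j) = (\<Oplus>j\<in>{..<Suc n}. A $$ (i, j) \<otimes> Q $$ (j, 0) \<otimes> g)"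
        by (rule finsum_cong') (use i in \<open>auto simp: qQ m_assoc mats_entry[OF A] mats_entry[OF Qm]\<close>)
      also have "\<dots> = (\<Oplus>j\<in>{..<Suc n}. A $$ (i, j) \<otimes> Q $$ (j, 0)) \<otimes> g"
        by (rule finsum_ldistr[symmetric]) (use i in \<open>auto simp: mats_entry[OF A] mats_entry[OF Qm]\<close>)
      also have "\<dots> = P $$ (i, 0) \<otimes> h \<otimes> g"
        using BP[OF i] mmult_entry[OF A Qm i, of 0] by simp
      finally show ?thesis using i hN N by (simp add: maximalideal_mult_iff mats_entry[OF Pm])
    qed
    then show False using unq N by (auto simp: unimodular_def)
  qed
  then obtain w where w [simp]: "w \<in> carrier R" and hw: "h \<otimes> w = \<one>"
    using unit_if_no_maximalideal[OF h] by blast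
  obtain P' where P': "P' \<in> invertible_mats R (Suc m)" and P'P: "mmult R P' P = mone R (Suc m)"
    using P by (rule invertible_matsE)
  note P'm = invertible_in_mats[OF P']
  let ?C = "mmult R P' ?B"
  have C: "?C \<in> mats R (Suc m) (Suc n)" by (rule mmult_in_mats[OF P'm B])
  have C0: "?C $$ (i, 0) = (if i = 0 then h else \<zero>)" if i: "i < Suc m" for i
  proof -
    have "?C $$ (i, 0) = (\<Oplus>l\<in>{..<Suc m}. P' $$ (i, l) \<otimes> P $$ (l, 0) \<otimes> h)"
      unfolding mmult_entry[OF P'm B i zero_less_Suc]
      by (rule finsum_cong') (use i in \<open>auto simp: BP m_assoc mats_entry[OF P'm] mats_entry[OF Pm]\<close>)
    also have "\<dots> = (\<Oplus>l\<in>{..<Suc m}. P' $$ (i, l) \<otimes> P $$ (l, 0)) \<otimes> h"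
      by (rule finsum_ldistr[symmetric]) (use i in \<open>auto simp: mats_entry[OF P'm] mats_entry[OF Pm]\<close>)
    also have "(\<Oplus>l\<in>{..<Suc m}. P' $$ (i, l) \<otimes> P $$ (l, 0)) = mone R (Suc m) $$ (i, 0)"
      using mmult_entry[OF P'm Pm i zero_less_Suc] P'P by simp
    finally show ?thesis using i by (simp add: mone_entry)
  qed
  define r where "r j = ?C $$ (0, j)" for j
  have r: "r j \<in> carrier R" if "j < Suc n" for j using mats_entry[OF C] that by (simp add: r_def)
  have r0: "r 0 \<otimes> w = \<one>" using C0[of 0] hw by (simp add: r_def)
  let ?T = "first_row_mat (Suc n) r"
  let ?T' = "first_row_mat (Suc n) (\<lambda>j. if j = 0 then w else \<ominus> (w \<otimes> r j))"
  have T: "?T \<in> mats R (Suc n) (Suc n)" by (rule first_row_mat_in_mats) (rule r)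
  have T': "?T' \<in> mats R (Suc n) (Suc n)" by (rule first_row_mat_in_mats) (use r in auto)
  note TT' = first_row_mat_mmult_mone[of "Suc n" r w, OF r w r0]
  define D where "D = mat m n (\<lambda>(i, j). ?C $$ (Suc i, Suc j))"
  have D: "D \<in> mats R m n" unfolding D_def by (rule mat_in_mats) (use mats_entry[OF C] in auto)
  note UD = unit_block_in_mats[OF D]
  \<comment> \<open>Below its first row \<open>?C\<close> starts with zeros, and its first row is
    that of \<open>?T\<close>. Hence \<open>?T\<close> splits off on the right, and the column
    operation \<open>?T'\<close> clears the first row.\<close>
  have "mmult R (unit_block m n D) ?T = ?C"
  proof (rule mats_eqI[OF mmult_in_mats[OF UD T] C])
    fix i j assume i: "i < Suc m" and j: "j < Suc n"
    have eq: "mmult R (unit_block m n D) ?T $$ (i, j)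
        = unit_block m n D $$ (i, 0) \<otimes> r j
          \<oplus> (\<Oplus>l\<in>{..<n}. unit_block m n D $$ (i, Suc l) \<otimes> (if Suc l = j then \<one> else \<zero>))"
    proof -
      have "mmult R (unit_block m n D) ?T $$ (i, j)
        = unit_block m n D $$ (i, 0) \<otimes> ?T $$ (0, j)
          \<oplus> (\<Oplus>l\<in>{..<n}. unit_block m n D $$ (i, Suc l) \<otimes> ?T $$ (Suc l, j))"
        unfolding mmult_entry[OF UD T i j]
        by (rule finsum_lessThan_Suc_shift) (use i j in \<open>auto simp: mats_entry[OF UD] mats_entry[OF T]\<close>)
      moreover have "(\<Oplus>l\<in>{..<n}. unit_block m n D $$ (i, Suc l) \<otimes> ?T $$ (Suc l, j))
        = (\<Oplus>l\<in>{..<n}. unit_block m n D $$ (i, Suc l) \<otimes> (if Suc l = j then \<one> else \<zero>))"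
        by (rule finsum_cong') (use i j in \<open>auto simp: mats_entry[OF UD] first_row_mat_def\<close>)
      ultimately show ?thesis using j by (simp add: first_row_mat_def)
    qed
    have tail: "(\<Oplus>l\<in>{..<n}. unit_block m n D $$ (i, Suc l) \<otimes> (if Suc l = j then \<one> else \<zero>))
        = (if j = 0 then \<zero> else unit_block m n D $$ (i, j))"
    proof (cases j)
      case 0
      then show ?thesis using i by (auto intro!: add.finprod_one_eqI simp: mats_entry[OF UD])
    next
      case (Suc j')
      have "(\<Oplus>l\<in>{..<n}. unit_block m n D $$ (i, Suc l) \<otimes> (if Suc l = j then \<one> else \<zero>))
          = unit_block m n D $$ (i, Suc j') \<otimes> (if Suc j' = j then \<one> else \<zero>)"
        by (rule finsum_support_single) (use Suc i j in \<open>auto simp: mats_entry[OF UD]\<close>)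
      then show ?thesis using Suc i j by (simp add: mats_entry[OF UD])
    qed
    show "mmult R (unit_block m n D) ?T $$ (i, j) = ?C $$ (i, j)"
      unfolding eq tail using i j r[OF j] C0
      by (cases i; cases j) (auto simp: r_def D_def mats_entry[OF C])
  qed
  then have "mmult R ?C ?T' = mmult R (unit_block m n D) (mmult R ?T ?T')"
    using mmult_assoc[OF UD T T'] by simp
  then have "mmult R ?C ?T' = unit_block m n D"
    using TT'(1) by (simp add: mmult_mone_right[OF UD])
  moreover have "?C = mmult R (mmult R P' A) Q" by (rule mmult_assoc[OF P'm A Qm, symmetric])
  moreover have "mmult R (mmult R (mmult R P' A) Q) ?T' = mmult R (mmult R P' A) (mmult R Q ?T')"
    by (rule mmult_assoc[OF mmult_in_mats[OF P'm A] Qm T'])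
  ultimately have "unit_block m n D = mmult R (mmult R P' A) (mmult R Q ?T')" by simp
  moreover have "?T' \<in> invertible_mats R (Suc n)" by (rule invertible_matsI[OF T' T TT'(2,1)])
  ultimately have "mat_equiv (Suc m) (Suc n) A (unit_block m n D)"
    by (intro mat_equivI[OF A P' invertible_mmult[OF Q]])
  then show ?thesis using D by blast
qed

text \<open>Write \<open>A = g W\<close> with unimodular \<open>W\<close>, bring \<open>W\<close> to
  block form with a leading 1, and recurse into the remaining block. The 1 divides the next diagonal
  entry, and multiplication by \<open>g\<close> preserves divisibility.\<close>

lemma mat_equiv_diagonal:
  assumes "A \<in> mats R m n"
  shows "\<exists>D\<in>mats R m n. mat_equiv m n A D \<and> diagonal_divisibility_form R D"
  using assms
proof (induction m arbitrary: n A)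
  case 0
  then have "diagonal_divisibility_form R A" by (simp add: diagonal_divisibility_form_def mats_dim)
  then show ?case using mat_equiv_refl[OF 0] 0 by blast
next
  case (Suc m)
  show ?case
  proof (cases n)
    case 0
    then have "diagonal_divisibility_form R A"
      using Suc.prems by (simp add: diagonal_divisibility_form_def mats_dim)
    then show ?thesis using mat_equiv_refl[OF Suc.prems] Suc.prems by blast
  next
    case n: (Suc n')
    let ?I = "{..<Suc m} \<times> {..<Suc n'}"
    have "(\<lambda>(i, j). A $$ (i, j)) \<in> ?I \<rightarrow> carrier R" using mats_entry[OF Suc.prems] n by auto
    moreover have "finite ?I" "?I \<noteq> {}" by auto
    ultimately obtain g w s where g [simp]: "g \<in> carrier R" and w: "w \<in> ?I \<rightarrow> carrier R"
      and s: "s \<in> ?I \<rightarrow> carrier R" and Aw: "\<forall>ij\<in>?I. (\<lambda>(i, j). A $$ (i, j)) ij = g \<otimes> w ij"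
      and sw: "(\<Oplus>ij\<in>?I. s ij \<otimes> w ij) = \<one>"
      using hermite_family[of ?I "\<lambda>(i, j). A $$ (i, j)"] by (elim meta_impE bexE conjE)
    define W where "W = mat (Suc m) (Suc n') w"
    have W: "W \<in> mats R (Suc m) (Suc n')" unfolding W_def by (rule mat_in_mats) (use w in auto)
    have W_entry: "W $$ (i, j) = w (i, j)" if "i < Suc m" "j < Suc n'" for i j
      using that by (simp add: W_def)
    have A_eq: "A = scale_mat g W"
      by (rule mats_eqI[OF Suc.prems[unfolded n] scale_mat_in_mats[OF g W]])
        (use Aw in \<open>auto simp: scale_mat_entry[OF W] W_entry\<close>)
    have "unimodular ((\<lambda>(i, j). W $$ (i, j)) ` ?I)" unfolding unimodular_def
    proof (intro allI impI notI)
      fix N assume N: "maximalideal N R" and sub: "(\<lambda>(i, j). W $$ (i, j)) ` ?I \<subseteq> N"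
      have "s ij \<otimes> w ij \<in> N" if "ij \<in> ?I" for ij
        using that sub N w s by (auto simp: W_entry maximalideal_mult_iff Pi_iff image_subset_iff)
      then have "(\<Oplus>ij\<in>?I. s ij \<otimes> w ij) \<in> N" by (rule maximalideal_finsum[OF N])
      then show False using N by (simp add: sw maximalideal_one)
    qed
    then obtain B where B: "B \<in> mats R m n'" and WB: "mat_equiv (Suc m) (Suc n') W (unit_block m n' B)"
      using unimodular_mat_equiv_unit_block[OF W] by blast
    obtain D where D: "D \<in> mats R m n'" and BD: "mat_equiv m n' B D"
      and diag: "diagonal_divisibility_form R D" using Suc.IH[OF B] by blast
    let ?D = "scale_mat g (unit_block m n' D)"
    note UD = unit_block_in_mats[OF D]
    have "mat_equiv (Suc m) (Suc n') A ?D"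
      unfolding A_eq by (rule mat_equiv_scale[OF g mat_equiv_trans[OF WB mat_equiv_unit_block[OF BD]]])
    moreover have D': "?D \<in> mats R (Suc m) (Suc n')" by (rule scale_mat_in_mats[OF g UD])
    moreover have "diagonal_divisibility_form R ?D"
      unfolding diagonal_divisibility_form_def mats_dim[OF D']
    proof (intro conjI allI impI)
      fix i j assume ij: "i < Suc m" "j < Suc n'" "i \<noteq> j"
      then have "unit_block m n' D $$ (i, j) = \<zero>"
        using diag D by (cases i; cases j) (auto simp: diagonal_divisibility_form_def mats_dim[OF D])
      then show "?D $$ (i, j) = \<zero>" using ij by (simp add: scale_mat_entry[OF UD])
    next
      fix i assume i: "Suc i < min (Suc m) (Suc n')"
      let ?U = "unit_block m n' D"
      have "\<exists>c\<in>carrier R. ?U $$ (Suc i, Suc i) = ?U $$ (i, i) \<otimes> c"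
      proof (cases i)
        case 0
        then show ?thesis using i mats_entry[OF D, of 0 0] by auto
      next
        case (Suc i')
        then have "D $$ (i', i') divides D $$ (Suc i', Suc i')"
          using diag i by (auto simp: diagonal_divisibility_form_def mats_dim[OF D])
        then show ?thesis using Suc i by (auto simp: factor_def)
      qed
      then obtain c where "c \<in> carrier R" "?U $$ (Suc i, Suc i) = ?U $$ (i, i) \<otimes> c" by blast
      then show "?D $$ (i, i) divides ?D $$ (Suc i, Suc i)"
        using i mats_entry[OF UD, of i i] by (auto simp: scale_mat_entry[OF UD] factor_def m_assoc)
    qed
    ultimately show ?thesis unfolding n by blast
  qed
qed

lemma is_elementary_divisor_ring: "elementary_divisor_ring R"
  unfolding elementary_divisor_ring_def
proof (intro allI ballI)
  fix m n A assume "A \<in> mats R m n"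
  then obtain D where "mat_equiv m n A D" "diagonal_divisibility_form R D"
    using mat_equiv_diagonal by blast
  then show "\<exists>P\<in>invertible_mats R m. \<exists>Q\<in>invertible_mats R n.
      diagonal_divisibility_form R (mmult R (mmult R P A) Q)"
    by (auto simp: mat_equiv_def)
qed

end

theorem theorem12:
  fixes R :: "('a, 'r) ring_scheme"
  assumes "cring R"
    and "semihereditary R"
    and "bezout_ring R"
    and "countable_character R"
  shows "elementary_divisor_ring R"
proof -
  interpret cring R by fact
  interpret pp_ring R
    by unfold_locales (rule semihereditary_annihilator_idempotent[OF assms(2)])
  interpret countable_pp_hermite_ring R
    by unfold_locales (simp_all only: bezout_hermite[OF assms(3)] assms(4))
  show ?thesis by (rule is_elementary_divisor_ring)
qed

end
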